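(* Let $R$ be a finite commutative ring with $1$. Then the category of $\mathrm{SI}(R)$-modules is locally Noetherian.
   Context: All rings are commutative with $1$. A symplectic form on a finite-rank free $R$-module $V$ is a bilinear form $\omega:V\times V\to R$ which is alternating ($\omega(v,v)=0$ for all $v$) and which induces an isomorphism $V\to\operatorname{Hom}_R(V,R)$. A symplectic $R$-module is a finite-rank free $R$-module equipped with a symplectic form. $\mathrm{SI}(R)$ is the category whose objects are symplectic $R$-modules and whose morphisms are $R$-linear maps preserving the symplectic forms (such maps are automatically injective). For a category $\mathsf{C}$ and a ring $\mathbf{k}$, a $\mathsf{C}$-module over $\mathbf{k}$ is a functor $M$ from $\mathsf{C}$ to $\mathbf{k}$-modules, with value $M_C$ at an object $C$; morphisms are natural transformations, and submodules are defined pointwise. $M$ is finitely generated if there are finitely many objects $C_1,\dots,C_n$ and elements $x_i\in M_{C_i}$ such that the smallest $\mathsf{C}$-submodule of $M$ containing all $x_i$ is $M$. The category of $\mathsf{C}$-modules over $\mathbf{k}$ is locally Noetherian if every submodule of a finitely generated $\mathsf{C}$-module over $\mathbf{k}$ is finitely generated. The category of $\mathsf{C}$-modules is locally Noetherian if this holds over every Noetherian ring $\mathbf{k}$. *)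

theory Defs
  imports "HOL-Algebra.Module" "HOL-Algebra.Ring_Divisibility"
begin

definition linear_map ::
    "('r, 'x) ring_scheme \<Rightarrow> ('r, 'v, 'y) module_scheme \<Rightarrow> ('r, 'w, 'z) module_scheme
      \<Rightarrow> ('v \<Rightarrow> 'w) \<Rightarrow> bool" where
  "linear_map R V W f \<longleftrightarrow>
     f \<in> carrier V \<rightarrow> carrier W \<and>
     (\<forall>x\<in>carrier V. \<forall>y\<in>carrier V. f (x \<oplus>\<^bsub>V\<^esub> y) = f x \<oplus>\<^bsub>W\<^esub> f y) \<and>
     (\<forall>a\<in>carrier R. \<forall>x\<in>carrier V. f (a \<odot>\<^bsub>V\<^esub> x) = a \<odot>\<^bsub>W\<^esub> f x)"

definition regular_module :: "('r, 'x) ring_scheme \<Rightarrow> ('r, 'r) module" where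
  "regular_module R =
     \<lparr>carrier = carrier R, monoid.mult = monoid.mult R, one = one R, ring.zero = ring.zero R,
      add = add R, smult = monoid.mult R\<rparr>"

text \<open>Elements of \<open>Hom\<^sub>R(V, W)\<close> are functions on the whole type that are
  \<open>undefined\<close> off the carrier of \<open>V\<close>, so that two linear maps are equal iff they agree
  on the carrier.\<close>

definition linear_maps ::
    "('r, 'x) ring_scheme \<Rightarrow> ('r, 'v, 'y) module_scheme \<Rightarrow> ('r, 'w, 'z) module_scheme
      \<Rightarrow> ('v \<Rightarrow> 'w) set" where
  "linear_maps R V W = {f \<in> extensional (carrier V). linear_map R V W f}"

text \<open>A basis is an indexed family rather than a set, so that the definition is also the
  usual one over the zero ring.\<close>

definition finite_rank_free ::
    "('r, 'x) ring_scheme \<Rightarrow> ('r, 'v, 'y) module_scheme \<Rightarrow> bool" where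
  "finite_rank_free R V \<longleftrightarrow>
     (\<exists>(n::nat) b. b \<in> {..<n} \<rightarrow> carrier V \<and>
        (\<forall>v\<in>carrier V. \<exists>!c. c \<in> {..<n} \<rightarrow>\<^sub>E carrier R \<and>
           v = finsum V (\<lambda>i. c i \<odot>\<^bsub>V\<^esub> b i) {..<n}))"

record ('r, 'v) symplectic = "('r, 'v) module" +
  form :: "'v \<Rightarrow> 'v \<Rightarrow> 'r"

text \<open>In the last conjunct the map \<open>v \<mapsto> \<omega>(v, -)\<close> is automatically linear by bilinearity,
  so it is an isomorphism onto the dual module iff it is a bijection.\<close>

definition symplectic_form ::
    "('r, 'x) ring_scheme \<Rightarrow> ('r, 'v, 'y) module_scheme \<Rightarrow> ('v \<Rightarrow> 'v \<Rightarrow> 'r) \<Rightarrow> bool" where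
  "symplectic_form R V \<omega> \<longleftrightarrow>
     (\<forall>v\<in>carrier V. linear_map R V (regular_module R) (\<lambda>w. \<omega> v w)) \<and>
     (\<forall>w\<in>carrier V. linear_map R V (regular_module R) (\<lambda>v. \<omega> v w)) \<and>
     (\<forall>v\<in>carrier V. \<omega> v v = \<zero>\<^bsub>R\<^esub>) \<and>
     bij_betw (\<lambda>v. \<lambda>w\<in>carrier V. \<omega> v w)
       (carrier V) (linear_maps R V (regular_module R))"

definition symplectic_module ::
    "('r, 'x) ring_scheme \<Rightarrow> ('r, 'v, 'y) symplectic_scheme \<Rightarrow> bool" where
  "symplectic_module R V \<longleftrightarrow>
     module R V \<and> finite_rank_free R V \<and> symplectic_form R V (form V)"

text \<open>Hom-sets of different pairs of objects need not be disjoint; composition and, below,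
  the action of a functor therefore take the source and target objects as arguments.
  \<open>Comp C X Y Z g f\<close> is \<open>g\<close> after \<open>f\<close> for \<open>f : X \<rightarrow> Y\<close> and \<open>g : Y \<rightarrow> Z\<close>.\<close>

record ('o, 'f) category =
  Obj :: "'o set"
  Mor :: "'o \<Rightarrow> 'o \<Rightarrow> 'f set"
  Ident :: "'o \<Rightarrow> 'f"
  Comp :: "'o \<Rightarrow> 'o \<Rightarrow> 'o \<Rightarrow> 'f \<Rightarrow> 'f \<Rightarrow> 'f"

locale category =
  fixes C :: "('o, 'f) category"
  assumes Ident_closed: "X \<in> Obj C \<Longrightarrow> Ident C X \<in> Mor C X X"
    and Comp_closed:
      "\<lbrakk>X \<in> Obj C; Y \<in> Obj C; Z \<in> Obj C; f \<in> Mor C X Y; g \<in> Mor C Y Z\<rbrakk>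
        \<Longrightarrow> Comp C X Y Z g f \<in> Mor C X Z"
    and Comp_Ident_right:
      "\<lbrakk>X \<in> Obj C; Y \<in> Obj C; f \<in> Mor C X Y\<rbrakk> \<Longrightarrow> Comp C X X Y f (Ident C X) = f"
    and Comp_Ident_left:
      "\<lbrakk>X \<in> Obj C; Y \<in> Obj C; f \<in> Mor C X Y\<rbrakk> \<Longrightarrow> Comp C X Y Y (Ident C Y) f = f"
    and Comp_assoc:
      "\<lbrakk>W \<in> Obj C; X \<in> Obj C; Y \<in> Obj C; Z \<in> Obj C;
        f \<in> Mor C W X; g \<in> Mor C X Y; h \<in> Mor C Y Z\<rbrakk>
        \<Longrightarrow> Comp C W X Z (Comp C X Y Z h g) f = Comp C W Y Z h (Comp C W X Y g f)"

record ('o, 'f, 'k, 'm) cat_mod =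
  Val :: "'o \<Rightarrow> ('k, 'm) module"
  Act :: "'o \<Rightarrow> 'o \<Rightarrow> 'f \<Rightarrow> 'm \<Rightarrow> 'm"

locale cat_module = category C + cring k
  for C :: "('o, 'f) category" and k :: "'k ring" +
  fixes M :: "('o, 'f, 'k, 'm) cat_mod"
  assumes Val_module: "X \<in> Obj C \<Longrightarrow> module k (Val M X)"
    and Act_linear:
      "\<lbrakk>X \<in> Obj C; Y \<in> Obj C; f \<in> Mor C X Y\<rbrakk>
        \<Longrightarrow> linear_map k (Val M X) (Val M Y) (Act M X Y f)"
    and Act_Ident:
      "\<lbrakk>X \<in> Obj C; x \<in> carrier (Val M X)\<rbrakk> \<Longrightarrow> Act M X X (Ident C X) x = x"
    and Act_Comp:
      "\<lbrakk>X \<in> Obj C; Y \<in> Obj C; Z \<in> Obj C; f \<in> Mor C X Y; g \<in> Mor C Y Z;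
        x \<in> carrier (Val M X)\<rbrakk>
        \<Longrightarrow> Act M X Z (Comp C X Y Z g f) x = Act M Y Z g (Act M X Y f x)"

definition cat_submodule ::
    "('o, 'f) category \<Rightarrow> 'k ring \<Rightarrow> ('o, 'f, 'k, 'm) cat_mod \<Rightarrow> ('o \<Rightarrow> 'm set) \<Rightarrow> bool" where
  "cat_submodule C k M N \<longleftrightarrow>
     (\<forall>X\<in>Obj C. submodule (N X) k (Val M X)) \<and>
     (\<forall>X\<in>Obj C. \<forall>Y\<in>Obj C. \<forall>f\<in>Mor C X Y. \<forall>x\<in>N X. Act M X Y f x \<in> N Y)"

definition submodule_cat_mod ::
    "('o, 'f, 'k, 'm) cat_mod \<Rightarrow> ('o \<Rightarrow> 'm set) \<Rightarrow> ('o, 'f, 'k, 'm) cat_mod" where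
  "submodule_cat_mod M N = M\<lparr>Val := \<lambda>X. (Val M X)\<lparr>carrier := N X\<rparr>\<rparr>"

definition generated_submodule ::
    "('o, 'f) category \<Rightarrow> 'k ring \<Rightarrow> ('o, 'f, 'k, 'm) cat_mod \<Rightarrow> ('o \<times> 'm) set
      \<Rightarrow> 'o \<Rightarrow> 'm set" where
  "generated_submodule C k M S X =
     \<Inter> {N X | N. cat_submodule C k M N \<and> (\<forall>(Y, y)\<in>S. y \<in> N Y)}"

definition finitely_generated ::
    "('o, 'f) category \<Rightarrow> 'k ring \<Rightarrow> ('o, 'f, 'k, 'm) cat_mod \<Rightarrow> bool" where
  "finitely_generated C k M \<longleftrightarrow>
     (\<exists>S. finite S \<and> S \<subseteq> (SIGMA X:Obj C. carrier (Val M X)) \<and>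
          (\<forall>X\<in>Obj C. generated_submodule C k M S X = carrier (Val M X)))"

text \<open>The type arguments fix the types in which the carriers of the values of the functors
  and of the coefficient rings live. They are arbitrary, but cannot be quantified inside a
  definition.\<close>

definition locally_noetherian_over ::
    "('o, 'f) category \<Rightarrow> 'k ring \<Rightarrow> 'm itself \<Rightarrow> bool" where
  "locally_noetherian_over C k (_ :: 'm itself) \<longleftrightarrow>
     (\<forall>(M :: ('o, 'f, 'k, 'm) cat_mod) N.
        cat_module C k M \<longrightarrow> finitely_generated C k M \<longrightarrow> cat_submodule C k M N \<longrightarrow>
        finitely_generated C k (submodule_cat_mod M N))"

definition locally_noetherian ::
    "('o, 'f) category \<Rightarrow> 'k itself \<Rightarrow> 'm itself \<Rightarrow> bool" where
  "locally_noetherian C (_ :: 'k itself) TM \<longleftrightarrow>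
     (\<forall>k :: 'k ring. cring k \<longrightarrow> noetherian_ring k \<longrightarrow> locally_noetherian_over C k TM)"

lemma submodule_cat_mod_is_cat_module:
  assumes M: "cat_module C k M" and N: "cat_submodule C k M N"
  shows "cat_module C k (submodule_cat_mod M N)"
proof -
  interpret cat_module C k M by (rule M)
  have sub: "submodule (N X) k (Val M X)" if "X \<in> Obj C" for X
    using N that by (simp add: cat_submodule_def)
  have in_carrier: "x \<in> carrier (Val M X)" if "X \<in> Obj C" "x \<in> N X" for X x
    using module.submoduleE(1)[OF Val_module[OF that(1)] sub[OF that(1)]] that(2) by blast
  have closed: "Act M X Y f x \<in> N Y"
    if "X \<in> Obj C" "Y \<in> Obj C" "f \<in> Mor C X Y" "x \<in> N X" for X Y f x
    using N that by (simp add: cat_submodule_def)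
  show ?thesis
  proof (intro cat_module.intro cat_module_axioms.intro)
    fix X assume X: "X \<in> Obj C"
    show "module k (Val (submodule_cat_mod M N) X)"
      using submodule.submodule_is_module[OF sub[OF X] Val_module[OF X]]
      by (simp add: submodule_cat_mod_def)
  next
    fix X Y f assume "X \<in> Obj C" "Y \<in> Obj C" "f \<in> Mor C X Y"
    then show "linear_map k (Val (submodule_cat_mod M N) X) (Val (submodule_cat_mod M N) Y)
        (Act (submodule_cat_mod M N) X Y f)"
      using Act_linear[of X Y f]
      by (auto simp: submodule_cat_mod_def linear_map_def in_carrier closed)
  qed (auto simp: submodule_cat_mod_def Act_Ident Act_Comp in_carrier
        intro: category_axioms is_cring)
qed

text \<open>The objects are the symplectic modules whose carrier is a subset of the type \<open>'v\<close>.
  If the ring is finite, then so is each symplectic module over it; hence every infinite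
  type \<open>'v\<close> contains a copy of each of them.\<close>

definition SI ::
    "('r, 'x) ring_scheme \<Rightarrow> (('r, 'v) symplectic, 'v \<Rightarrow> 'v) category" where
  "SI R =
     \<lparr>Obj = {V. symplectic_module R V},
      Mor = (\<lambda>V W. {f \<in> linear_maps R V W.
               \<forall>x\<in>carrier V. \<forall>y\<in>carrier V. form W (f x) (f y) = form V x y}),
      Ident = (\<lambda>V. \<lambda>x\<in>carrier V. x),
      Comp = (\<lambda>U V W g f. compose (carrier U) g f)\<rparr>"

lemma SI_category: "category (SI R)"
proof
  fix V assume "V \<in> Obj (SI R)"
  then have "module R V" by (simp add: SI_def symplectic_module_def)
  then interpret module R V .
  show "Ident (SI R) V \<in> Mor (SI R) V V"
    by (auto simp: SI_def linear_maps_def linear_map_def)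
next
  fix U V W f g
  assume "U \<in> Obj (SI R)" "V \<in> Obj (SI R)" "W \<in> Obj (SI R)"
    and f: "f \<in> Mor (SI R) U V" and g: "g \<in> Mor (SI R) V W"
  then have "module R U" by (simp add: SI_def symplectic_module_def)
  then interpret module R U .
  show "Comp (SI R) U V W g f \<in> Mor (SI R) U W"
    using f g by (auto simp: SI_def linear_maps_def linear_map_def compose_def Pi_iff)
next
  fix V W f
  assume "f \<in> Mor (SI R) V W"
  then show "Comp (SI R) V V W f (Ident (SI R) V) = f"
    and "Comp (SI R) V W W (Ident (SI R) W) f = f"
    by (auto simp: SI_def linear_maps_def linear_map_def compose_def Pi_iff extensional_def
        fun_eq_iff)
qed (auto simp: SI_def linear_maps_def linear_map_def compose_def Pi_iff fun_eq_iff)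

end

theory Submission
  imports Defs
    "HOL-Library.Sublist"
    "HOL-Library.Ramsey"
    "HOL-Library.Product_Lexorder"
    "HOL-Library.List_Lenlexorder"
    "HOL-Algebra.Multiplicative_Group"
begin

text \<open>Over a finite ring every symplectic module has a symplectic basis (\<open>hyperbolic_basis\<close>,
  \<open>symplectic_coordinates\<close>), so it is the space of \<open>n\<close>-tuples of pairs of scalars with the form
  that sums \<open>p q' - q p'\<close> over the positions. A morphism from a fixed \<open>X\<close> to a module of rank \<open>2n\<close>
  thus becomes a word of length \<open>n\<close> over the finite alphabet of functions from \<open>X\<close> to pairs of
  scalars.

  The key point is that there are many embeddings that act on words combinatorially. Let
  \<open>s : {..<n'} \<rightarrow> {..<n}\<close> be a surjection all of whose fibres have size 1 modulo \<open>N = |R|\<close>. Since \<open>N\<close> kills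
  \<open>R\<close>, the map \<open>x \<mapsto> (x\<^bsub>s j\<^esub>)\<^sub>j\<close> preserves the symplectic form, and composing a morphism
  with it composes the word with \<open>s\<close> (\<open>regular_surj_morphism\<close>). If moreover the fibres of \<open>s\<close> start
  in increasing order, the lexicographic order of words is preserved (\<open>regular_surj_less\<close>).

  Write \<open>u \<le> w\<close> if \<open>w\<close> arises from \<open>u\<close> in this way. This has a good pair in every infinite sequence of
  words (\<open>regular_surj_good_pair\<close>): mark in each word the first occurrences of the letters, restrict
  to words with equal letter sets and equal letter counts modulo \<open>N\<close>, and apply Higman's lemma to the
  marked words. Letters that are added to \<open>u\<close> repeat earlier letters and occur in multiples of \<open>N\<close>.

  So the functors \<open>k[Hom(X, -)]\<close> have an order on their monomials that is compatible with
  divisibility, and divisibility is a well-quasi-order. The theorem follows by the argument of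
  Hilbert's basis theorem (\<open>groebner_criterion\<close>), carried out in any finitely generated functor for all its
  generators at once.\<close>

section \<open>Spans and generated submodules\<close>

inductive_set module_span ::
    "('r, 'x) ring_scheme \<Rightarrow> ('r, 'v, 'y) module_scheme \<Rightarrow> 'v set \<Rightarrow> 'v set"
  for R :: "('r, 'x) ring_scheme" and V :: "('r, 'v, 'y) module_scheme" and G :: "'v set"
  where
    span_zero: "\<zero>\<^bsub>V\<^esub> \<in> module_span R V G"
  | span_step: "\<lbrakk>a \<in> carrier R; g \<in> G; z \<in> module_span R V G\<rbrakk>
      \<Longrightarrow> a \<odot>\<^bsub>V\<^esub> g \<oplus>\<^bsub>V\<^esub> z \<in> module_span R V G"

lemma module_span_mono: "G \<subseteq> H \<Longrightarrow> module_span R V G \<subseteq> module_span R V H"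
proof
  fix z assume "G \<subseteq> H" "z \<in> module_span R V G"
  from this(2,1) show "z \<in> module_span R V H"
    by induction (auto intro: module_span.intros)
qed

context module
begin

lemma module_span_closed: "\<lbrakk>G \<subseteq> carrier M; z \<in> module_span R M G\<rbrakk> \<Longrightarrow> z \<in> carrier M"
  by (rotate_tac, induction rule: module_span.induct) auto

lemma module_span_incl: "\<lbrakk>G \<subseteq> carrier M; g \<in> G\<rbrakk> \<Longrightarrow> g \<in> module_span R M G"
  using span_step[of \<one> R g G "\<zero>\<^bsub>M\<^esub>" M] by (simp add: span_zero subset_iff)

lemma module_span_add:
  assumes G: "G \<subseteq> carrier M" and "y \<in> module_span R M G" "z \<in> module_span R M G"
  shows "y \<oplus>\<^bsub>M\<^esub> z \<in> module_span R M G"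
  using assms(2)
proof induction
  case span_zero
  then show ?case using assms module_span_closed by simp
next
  case (span_step a g y)
  then have "a \<odot>\<^bsub>M\<^esub> g \<oplus>\<^bsub>M\<^esub> y \<oplus>\<^bsub>M\<^esub> z = a \<odot>\<^bsub>M\<^esub> g \<oplus>\<^bsub>M\<^esub> (y \<oplus>\<^bsub>M\<^esub> z)"
    using G assms(3) module_span_closed by (intro M.a_assoc) auto
  then show ?case using span_step by (simp add: module_span.span_step)
qed

lemma module_span_smult:
  assumes G: "G \<subseteq> carrier M" and "b \<in> carrier R" "z \<in> module_span R M G"
  shows "b \<odot>\<^bsub>M\<^esub> z \<in> module_span R M G"
  using assms(3)
proof induction
  case span_zero
  then show ?case using assms by (simp add: module_span.span_zero)
next
  case (span_step a g y)
  then have "b \<odot>\<^bsub>M\<^esub> (a \<odot>\<^bsub>M\<^esub> g \<oplus>\<^bsub>M\<^esub> y) = (b \<otimes> a) \<odot>\<^bsub>M\<^esub> g \<oplus>\<^bsub>M\<^esub> b \<odot>\<^bsub>M\<^esub> y"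
    using G assms(2) module_span_closed by (simp add: smult_r_distr smult_assoc1 subset_iff)
  then show ?case using span_step assms(2) by (simp add: module_span.span_step)
qed

lemma module_span_neg:
  assumes G: "G \<subseteq> carrier M" and z: "z \<in> module_span R M G"
  shows "\<ominus>\<^bsub>M\<^esub> z \<in> module_span R M G"
  using module_span_smult[OF G _ z, of "\<ominus> \<one>"] smult_l_minus[of \<one> z] module_span_closed[OF G z]
  by simp

lemma module_span_submodule: "G \<subseteq> carrier M \<Longrightarrow> submodule (module_span R M G) R M"
  by (intro submoduleI) (auto intro: module_span_closed span_zero module_span_neg
      module_span_add module_span_smult)

lemma module_span_minimal:
  assumes H: "submodule H R M" and "G \<subseteq> H"
  shows "module_span R M G \<subseteq> H"
proof
  fix z assume "z \<in> module_span R M G"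
  then show "z \<in> H"
  proof induction
    case span_zero
    interpret subgroup H "add_monoid M" using H by (rule submodule.axioms)
    show ?case using one_closed by simp
  next
    case (span_step a g z)
    then show ?case using assms submoduleE(4,5)[OF H] by blast
  qed
qed

end

lemma linear_map_zero:
  assumes "module R V" "module R W" "linear_map R V W f"
  shows "f \<zero>\<^bsub>V\<^esub> = \<zero>\<^bsub>W\<^esub>"
proof -
  interpret V: module R V by fact
  interpret W: module R W by fact
  have "f (\<zero>\<^bsub>R\<^esub> \<odot>\<^bsub>V\<^esub> \<zero>\<^bsub>V\<^esub>) = \<zero>\<^bsub>R\<^esub> \<odot>\<^bsub>W\<^esub> f \<zero>\<^bsub>V\<^esub>" "f \<zero>\<^bsub>V\<^esub> \<in> carrier W"
    using assms(3) V.R.zero_closed V.M.zero_closed unfolding linear_map_def by blast+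
  then show ?thesis by simp
qed

lemma linear_map_module_span:
  assumes V: "module R V" and W: "module R W" and f: "linear_map R V W f"
    and G: "G \<subseteq> carrier V" and z: "z \<in> module_span R V G"
    and fG: "\<And>g. g \<in> G \<Longrightarrow> f g \<in> H"
  shows "f z \<in> module_span R W H"
  using z
proof induction
  case span_zero
  then show ?case using linear_map_zero[OF V W f] by (simp add: module_span.span_zero)
next
  case (span_step a g z)
  interpret V: module R V by fact
  have "f (a \<odot>\<^bsub>V\<^esub> g \<oplus>\<^bsub>V\<^esub> z) = a \<odot>\<^bsub>W\<^esub> f g \<oplus>\<^bsub>W\<^esub> f z"
    using f span_step G V.module_span_closed[OF G] by (simp add: linear_map_def subset_iff)
  then show ?case using span_step fG by (simp add: module_span.span_step)
qed

context cat_module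
begin

lemma generated_submodule_minimal:
  assumes "cat_submodule C k M N" "\<And>Y y. (Y, y) \<in> S \<Longrightarrow> y \<in> N Y"
  shows "generated_submodule C k M S X \<subseteq> N X"
  using assms unfolding generated_submodule_def by blast

lemma generated_submodule_incl: "(Y, y) \<in> S \<Longrightarrow> y \<in> generated_submodule C k M S Y"
  unfolding generated_submodule_def by blast

lemma cat_submodule_carrier: "cat_submodule C k M (\<lambda>X. carrier (Val M X))"
  unfolding cat_submodule_def
  using module.carrier_is_submodule[OF Val_module] Act_linear
  by (auto simp: linear_map_def dest!: funcset_mem)

lemma generated_submodule_is_submodule:
  assumes "S \<subseteq> (SIGMA X:Obj C. carrier (Val M X))"
  shows "cat_submodule C k M (generated_submodule C k M S)"
proof -
  define F where "F = {N. cat_submodule C k M N \<and> (\<forall>(Y, y)\<in>S. y \<in> N Y)}"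
  have gen: "generated_submodule C k M S X = (\<Inter>N\<in>F. N X)" for X
    by (auto simp: generated_submodule_def F_def)
  have carr: "(\<lambda>X. carrier (Val M X)) \<in> F"
    using cat_submodule_carrier assms by (auto simp: F_def)
  have sub: "submodule (N X) k (Val M X)" if "N \<in> F" "X \<in> Obj C" for N X
    using that by (simp add: F_def cat_submodule_def)
  show ?thesis
    unfolding cat_submodule_def gen
  proof (intro conjI ballI)
    fix X assume X: "X \<in> Obj C"
    interpret V: module k "Val M X" using X by (rule Val_module)
    show "submodule (\<Inter>N\<in>F. N X) k (Val M X)"
    proof (rule V.submoduleI)
      show "(\<Inter>N\<in>F. N X) \<subseteq> carrier (Val M X)" using carr by auto
      show "\<zero>\<^bsub>Val M X\<^esub> \<in> (\<Inter>N\<in>F. N X)"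
        using V.module_span_minimal[OF sub[OF _ X], of _ "{}"] span_zero by blast
      show "\<ominus>\<^bsub>Val M X\<^esub> y \<in> (\<Inter>N\<in>F. N X)" if "y \<in> (\<Inter>N\<in>F. N X)" for y
        using V.submoduleE(3)[OF sub[OF _ X]] that by simp
      show "y \<oplus>\<^bsub>Val M X\<^esub> z \<in> (\<Inter>N\<in>F. N X)"
        if "y \<in> (\<Inter>N\<in>F. N X)" "z \<in> (\<Inter>N\<in>F. N X)" for y z
        using V.submoduleE(5)[OF sub[OF _ X]] that by simp
      show "a \<odot>\<^bsub>Val M X\<^esub> y \<in> (\<Inter>N\<in>F. N X)"
        if "a \<in> carrier k" "y \<in> (\<Inter>N\<in>F. N X)" for a y
        using V.submoduleE(4)[OF sub[OF _ X]] that by simp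
    qed
  next
    fix X Y f y assume "X \<in> Obj C" "Y \<in> Obj C" "f \<in> Mor C X Y" "y \<in> (\<Inter>N\<in>F. N X)"
    then show "Act M X Y f y \<in> (\<Inter>N\<in>F. N Y)"
      by (auto simp: F_def cat_submodule_def)
  qed
qed

text \<open>A submodule of \<open>N\<close> is also one of \<open>M\<close>, so generation of \<open>N\<close> can be checked inside \<open>M\<close>.\<close>

lemma finitely_generated_submoduleI:
  assumes N: "cat_submodule C k M N"
    and S: "finite S" "S \<subseteq> (SIGMA X:Obj C. N X)"
    and le: "\<And>X. X \<in> Obj C \<Longrightarrow> N X \<subseteq> generated_submodule C k M S X"
  shows "finitely_generated C k (submodule_cat_mod M N)"
proof -
  let ?L = "submodule_cat_mod M N"
  have NV: "Val ?L X = (Val M X)\<lparr>carrier := N X\<rparr>" "Act ?L = Act M" for X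
    by (simp_all add: submodule_cat_mod_def)
  have subN: "submodule (N X) k (Val M X)" if "X \<in> Obj C" for X
    using N that by (simp add: cat_submodule_def)
  interpret L: cat_module C k ?L
    by (rule submodule_cat_mod_is_cat_module[OF cat_module_axioms N])
  have "generated_submodule C k ?L S X = N X" if X: "X \<in> Obj C" for X
  proof (intro equalityI)
    show "generated_submodule C k ?L S X \<subseteq> N X"
      using L.generated_submodule_minimal[OF L.cat_submodule_carrier, of S X] S by (auto simp: NV)
    have "cat_submodule C k M P" if P: "cat_submodule C k ?L P" for P
      unfolding cat_submodule_def
    proof (intro conjI ballI)
      fix Y assume Y: "Y \<in> Obj C"
      interpret V: module k "Val M Y" using Y by (rule Val_module)
      interpret LV: module k "Val ?L Y" using Y by (rule L.Val_module)
      have PY: "submodule (P Y) k (Val ?L Y)" using P Y by (simp add: cat_submodule_def)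
      have PN: "P Y \<subseteq> N Y" using LV.submoduleE(1)[OF PY] by (simp add: NV)
      have NM: "N Y \<subseteq> carrier (Val M Y)" using V.submoduleE(1)[OF subN[OF Y]] .
      show "submodule (P Y) k (Val M Y)"
      proof (rule V.submoduleI)
        show sm: "a \<odot>\<^bsub>Val M Y\<^esub> y \<in> P Y" if "a \<in> carrier k" "y \<in> P Y" for a y
          using LV.submoduleE(4)[OF PY that] by (simp add: NV)
        show "\<zero>\<^bsub>Val M Y\<^esub> \<in> P Y"
          using LV.module_span_minimal[OF PY, of "{}"] span_zero[of "Val ?L Y" k "{}"]
          by (auto simp: NV)
        show "\<ominus>\<^bsub>Val M Y\<^esub> y \<in> P Y" if "y \<in> P Y" for y
          using sm[of "\<ominus>\<^bsub>k\<^esub> \<one>\<^bsub>k\<^esub>" y] V.smult_l_minus[of "\<one>\<^bsub>k\<^esub>" y] that PN NM by auto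
        show "y \<oplus>\<^bsub>Val M Y\<^esub> z \<in> P Y" if "y \<in> P Y" "z \<in> P Y" for y z
          using LV.submoduleE(5)[OF PY that] by (simp add: NV)
      qed (use PN NM in blast)
    qed (use P in \<open>auto simp: cat_submodule_def NV\<close>)
    then have "generated_submodule C k M S X \<subseteq> generated_submodule C k ?L S X"
      unfolding generated_submodule_def by blast
    then show "N X \<subseteq> generated_submodule C k ?L S X" using le[OF X] by blast
  qed
  then show ?thesis
    unfolding finitely_generated_def using S by (intro exI[of _ S]) (simp add: NV)
qed

end

section \<open>Infinite sequences\<close>

text \<open>This is Ramsey's theorem for the two-colouring of the pairs by \<open>P\<close>: a homogeneous set of the
  wrong colour would be a subsequence without good pairs.\<close>

lemma good_imp_perfect_subsequence:
  fixes P :: "nat \<Rightarrow> nat \<Rightarrow> bool"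
  assumes good: "\<And>\<phi> :: nat \<Rightarrow> nat. strict_mono \<phi> \<Longrightarrow> \<exists>i j. i < j \<and> P (\<phi> i) (\<phi> j)"
  obtains \<phi> :: "nat \<Rightarrow> nat" where "strict_mono \<phi>" and "\<And>i j. i < j \<Longrightarrow> P (\<phi> i) (\<phi> j)"
proof -
  define c :: "nat set \<Rightarrow> nat" where "c X = (if P (Min X) (Max X) then 0 else 1)" for X
  obtain Y t where Y: "infinite Y" "\<forall>x\<in>Y. \<forall>y\<in>Y. x \<noteq> y \<longrightarrow> c {x, y} = t"
    using Ramsey2[of "UNIV :: nat set" c 2] by (metis (no_types, lifting) c_def
      infinite_UNIV_nat one_less_numeral_iff semiring_norm(76) zero_less_numeral)
  define \<phi> where "\<phi> = enumerate Y"
  have mono: "strict_mono \<phi>"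
    unfolding \<phi>_def by (rule strict_monoI) (rule enumerate_mono[OF _ Y(1)])
  have c: "c {\<phi> i, \<phi> j} = t" "c {\<phi> i, \<phi> j} = (if P (\<phi> i) (\<phi> j) then 0 else 1)" if "i < j" for i j
  proof -
    have less: "\<phi> i < \<phi> j" using mono that by (simp add: strict_mono_def)
    then have "\<phi> i \<noteq> \<phi> j" by simp
    then show "c {\<phi> i, \<phi> j} = t"
      using Y(2) enumerate_in_set[OF Y(1)] unfolding \<phi>_def by blast
    show "c {\<phi> i, \<phi> j} = (if P (\<phi> i) (\<phi> j) then 0 else 1)"
      using less by (simp add: c_def)
  qed
  obtain i j where "i < j" "P (\<phi> i) (\<phi> j)" using good[OF mono] by blast
  then have "t = 0" using c[of i j] by simp
  then have "P (\<phi> i) (\<phi> j)" if "i < j" for i j using c[OF that] by (simp split: if_splits)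
  with mono show thesis by (rule that)
qed

lemma (in noetherian_ring) sequence_in_earlier_ideal:
  fixes a :: "nat \<Rightarrow> 'a"
  assumes a: "\<And>i. a i \<in> carrier R"
  obtains j where "a j \<in> Idl (a ` {..<j})"
proof -
  define I where "I j = Idl (a ` {..<j})" for j
  have sub: "a ` A \<subseteq> carrier R" for A using a by blast
  have mono: "I i \<subseteq> I j" if "i \<le> j" for i j
    unfolding I_def using that genideal_self[OF sub]
    by (intro genideal_minimal genideal_ideal sub) fastforce
  have "subset.chain {I. ideal I R} (range I)"
    unfolding subset_chain_def
  proof (intro conjI ballI)
    show "range I \<subseteq> {I. ideal I R}" using genideal_ideal[OF sub] by (auto simp: I_def)
    fix x y assume "x \<in> range I" "y \<in> range I"
    then show "x \<subseteq> y \<or> y \<subseteq> x" using mono nat_le_linear by blast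
  qed
  then obtain j where j: "\<Union>(range I) = I j"
    using ideal_chain_is_trivial[of "range I"] by auto
  have "a j \<in> I (Suc j)" using genideal_self[OF sub[of "{..<Suc j}"]] by (auto simp: I_def)
  then have "a j \<in> I j" using j by blast
  then show thesis using that by (simp add: I_def)
qed

section \<open>A Groebner criterion for local Noetherianity\<close>

text \<open>This plays the role of divisibility between monomials: if \<open>f\<close> divides \<open>h\<close>, then some morphism
  carries every element with leading monomial \<open>f\<close> to one with leading monomial \<open>h\<close> and the same
  leading coefficient.\<close>

definition dominates ::
    "('o, 'f) category \<Rightarrow> ('o \<Rightarrow> 'o \<Rightarrow> 'f \<Rightarrow> 'w::wellorder) \<Rightarrow> 'o \<Rightarrow> 'o \<Rightarrow> 'f \<Rightarrow> 'o \<Rightarrow> 'f \<Rightarrow> bool" where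
  "dominates C rk X Y f Z h \<longleftrightarrow>
     (\<exists>g\<in>Mor C Y Z. Comp C X Y Z g f = h \<and>
        (\<forall>f'\<in>Mor C X Y. rk X Y f' < rk X Y f \<longrightarrow> rk X Z (Comp C X Y Z g f') < rk X Z h))"

text \<open>The pairs \<open>(t, f)\<close>, standing for the image of the generator \<open>x t\<close> under \<open>f\<close>, serve as monomials.
  They are ordered lexicographically, the index of the generator first, and \<open>below\<close> is the
  filtration of the values of the functor by this order.\<close>

locale ranked_generators = cat_module C k M
  for C :: "('o, 'f) category" and k :: "'k ring" and M :: "('o, 'f, 'k, 'm) cat_mod" +
  fixes rk :: "'o \<Rightarrow> 'o \<Rightarrow> 'f \<Rightarrow> 'w::wellorder"
    and r :: nat and G :: "nat \<Rightarrow> 'o" and x :: "nat \<Rightarrow> 'm"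
  assumes rk_inj: "\<lbrakk>X \<in> Obj C; Y \<in> Obj C\<rbrakk> \<Longrightarrow> inj_on (rk X Y) (Mor C X Y)"
    and G_Obj: "t < r \<Longrightarrow> G t \<in> Obj C"
    and x_carrier: "t < r \<Longrightarrow> x t \<in> carrier (Val M (G t))"
begin

definition monomials :: "'o \<Rightarrow> (nat \<times> 'f) set" where
  "monomials Y = (SIGMA t:{..<r}. Mor C (G t) Y)"

definition monomial_elem :: "'o \<Rightarrow> nat \<times> 'f \<Rightarrow> 'm" where
  "monomial_elem Y \<mu> = Act M (G (fst \<mu>)) Y (snd \<mu>) (x (fst \<mu>))"

definition rank :: "'o \<Rightarrow> nat \<times> 'f \<Rightarrow> nat \<times> 'w" where
  "rank Y \<mu> = (fst \<mu>, rk (G (fst \<mu>)) Y (snd \<mu>))"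

definition below :: "'o \<Rightarrow> nat \<times> 'w \<Rightarrow> 'm set" where
  "below Y \<rho> = module_span k (Val M Y) (monomial_elem Y ` {\<mu> \<in> monomials Y. rank Y \<mu> < \<rho>})"

lemma monomial_elem_carrier: "\<lbrakk>Y \<in> Obj C; \<mu> \<in> monomials Y\<rbrakk> \<Longrightarrow> monomial_elem Y \<mu> \<in> carrier (Val M Y)"
  using Act_linear[OF G_Obj, of "fst \<mu>" Y "snd \<mu>"] x_carrier[of "fst \<mu>"]
  by (auto simp: monomials_def monomial_elem_def linear_map_def)

lemma monomial_elem_set_carrier:
  "Y \<in> Obj C \<Longrightarrow> monomial_elem Y ` {\<mu> \<in> monomials Y. rank Y \<mu> < \<rho>} \<subseteq> carrier (Val M Y)"
  using monomial_elem_carrier by blast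

lemma below_mono: "\<rho> \<le> \<rho>' \<Longrightarrow> below Y \<rho> \<subseteq> below Y \<rho>'"
  unfolding below_def by (intro module_span_mono) auto

lemma below_submodule: "Y \<in> Obj C \<Longrightarrow> submodule (below Y \<rho>) k (Val M Y)"
  unfolding below_def
  by (intro module.module_span_submodule[OF Val_module] monomial_elem_set_carrier)

lemma rank_inj: "Y \<in> Obj C \<Longrightarrow> inj_on (rank Y) (monomials Y)"
  using rk_inj[OF G_Obj] by (auto simp: inj_on_def rank_def monomials_def)

definition push :: "'o \<Rightarrow> 'o \<Rightarrow> 'f \<Rightarrow> nat \<times> 'f \<Rightarrow> nat \<times> 'f" where
  "push Y Z g \<mu> = (fst \<mu>, Comp C (G (fst \<mu>)) Y Z g (snd \<mu>))"

lemma push_monomial: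
  assumes "Y \<in> Obj C" "Z \<in> Obj C" "g \<in> Mor C Y Z" "\<mu> \<in> monomials Y"
  shows "push Y Z g \<mu> \<in> monomials Z" and "Act M Y Z g (monomial_elem Y \<mu>) = monomial_elem Z (push Y Z g \<mu>)"
  using assms Comp_closed[OF G_Obj, of "fst \<mu>" Y Z "snd \<mu>" g]
    Act_Comp[OF G_Obj, of "fst \<mu>" Y Z "snd \<mu>" g "x (fst \<mu>)"] x_carrier[of "fst \<mu>"]
  by (auto simp: push_def monomials_def monomial_elem_def)

text \<open>Because the indices of the generators are compared first, a morphism that respects the
  ranks below one monomial respects them for the monomials of all other generators as well.\<close>

lemma Act_below:
  assumes Y: "Y \<in> Obj C" and Z: "Z \<in> Obj C" and g: "g \<in> Mor C Y Z" 
    and mono: "\<And>f'. \<lbrakk>f' \<in> Mor C (G t) Y; rk (G t) Y f' < rk (G t) Y f\<rbrakk>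
      \<Longrightarrow> rk (G t) Z (Comp C (G t) Y Z g f') < rk (G t) Z h"
    and z: "z \<in> below Y (rank Y (t, f))"
  shows "Act M Y Z g z \<in> below Z (rank Z (t, h))"
  unfolding below_def
proof (rule linear_map_module_span[OF Val_module[OF Y] Val_module[OF Z] Act_linear[OF Y Z g]
      monomial_elem_set_carrier[OF Y] z[unfolded below_def]])
  fix y assume "y \<in> monomial_elem Y ` {\<mu> \<in> monomials Y. rank Y \<mu> < rank Y (t, f)}"
  then obtain \<mu> where \<mu>: "\<mu> \<in> monomials Y" "rank Y \<mu> < rank Y (t, f)" "y = monomial_elem Y \<mu>" by blast
  have "rank Z (push Y Z g \<mu>) < rank Z (t, h)"
    using \<mu>(1,2) mono by (auto simp: rank_def push_def monomials_def)
  then show "Act M Y Z g y \<in> monomial_elem Z ` {\<mu> \<in> monomials Z. rank Z \<mu> < rank Z (t, h)}"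
    using push_monomial[OF Y Z g \<mu>(1)] \<mu>(3) by blast
qed

text \<open>The monomials may satisfy linear relations, so that an element can have several leading
  monomials and coefficients. The existence of one takes the place of the division with remainder
  that Groebner theory has in a free module.\<close>

lemma leading_monomial:
  assumes Y: "Y \<in> Obj C" and y: "y \<in> below Y \<rho>" "y \<noteq> \<zero>\<^bsub>Val M Y\<^esub>"
  obtains \<mu> a z where "\<mu> \<in> monomials Y" "rank Y \<mu> < \<rho>" "a \<in> carrier k" "z \<in> below Y (rank Y \<mu>)"
    and "y = a \<odot>\<^bsub>Val M Y\<^esub> monomial_elem Y \<mu> \<oplus>\<^bsub>Val M Y\<^esub> z"
proof -
  interpret V: module k "Val M Y" using Y by (rule Val_module)
  note sub = V.submoduleE[OF below_submodule[OF Y]]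
  have zero: "\<zero>\<^bsub>Val M Y\<^esub> \<in> below Y \<sigma>" for \<sigma> unfolding below_def by (rule span_zero)
  have "y = \<zero>\<^bsub>Val M Y\<^esub> \<or> (\<exists>\<mu>\<in>monomials Y. \<exists>a\<in>carrier k. \<exists>z\<in>below Y (rank Y \<mu>).
      rank Y \<mu> < \<rho> \<and> y = a \<odot>\<^bsub>Val M Y\<^esub> monomial_elem Y \<mu> \<oplus>\<^bsub>Val M Y\<^esub> z)"
    using y(1) unfolding below_def[of Y \<rho>]
  proof induction
    case span_zero
    then show ?case by simp
  next
    case (span_step b g y)
    then obtain \<nu> where \<nu>: "\<nu> \<in> monomials Y" "rank Y \<nu> < \<rho>" "g = monomial_elem Y \<nu>" by blast
    have g: "g \<in> carrier (Val M Y)" using \<nu> monomial_elem_carrier[OF Y] by simp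
    show ?case
      using span_step.IH
    proof
      assume "y = \<zero>\<^bsub>Val M Y\<^esub>"
      then show ?thesis using \<nu> zero span_step.hyps(1) by blast
    next
      assume "\<exists>\<mu>\<in>monomials Y. \<exists>a\<in>carrier k. \<exists>z\<in>below Y (rank Y \<mu>).
          rank Y \<mu> < \<rho> \<and> y = a \<odot>\<^bsub>Val M Y\<^esub> monomial_elem Y \<mu> \<oplus>\<^bsub>Val M Y\<^esub> z"
      then obtain \<mu> a z where \<mu>: "\<mu> \<in> monomials Y" "rank Y \<mu> < \<rho>" "a \<in> carrier k"
          and z: "z \<in> below Y (rank Y \<mu>)"
          and y: "y = a \<odot>\<^bsub>Val M Y\<^esub> monomial_elem Y \<mu> \<oplus>\<^bsub>Val M Y\<^esub> z" by blast
      have m: "monomial_elem Y \<mu> \<in> carrier (Val M Y)" using \<mu> monomial_elem_carrier[OF Y] by simp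
      have zc: "z \<in> carrier (Val M Y)" using z sub(1) by blast
      have gin: "g \<in> below Y \<sigma>" if "rank Y \<nu> < \<sigma>" for \<sigma>
        unfolding below_def using \<nu> that
        by (intro V.module_span_incl monomial_elem_set_carrier[OF Y]) auto
      have min: "monomial_elem Y \<mu> \<in> below Y \<sigma>" if "rank Y \<mu> < \<sigma>" for \<sigma>
        unfolding below_def using \<mu> that
        by (intro V.module_span_incl monomial_elem_set_carrier[OF Y]) auto
      consider "rank Y \<nu> < rank Y \<mu>" | "rank Y \<mu> < rank Y \<nu>" | "rank Y \<nu> = rank Y \<mu>"
        by (rule linorder_cases)
      then show ?thesis
      proof cases
        case 1
        have "b \<odot>\<^bsub>Val M Y\<^esub> g \<oplus>\<^bsub>Val M Y\<^esub> z \<in> below Y (rank Y \<mu>)"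
          using gin[OF 1] z span_step.hyps(1) sub(4,5) by blast
        moreover have "b \<odot>\<^bsub>Val M Y\<^esub> g \<oplus>\<^bsub>Val M Y\<^esub> y
            = a \<odot>\<^bsub>Val M Y\<^esub> monomial_elem Y \<mu> \<oplus>\<^bsub>Val M Y\<^esub> (b \<odot>\<^bsub>Val M Y\<^esub> g \<oplus>\<^bsub>Val M Y\<^esub> z)"
          unfolding y using g m zc \<mu>(3) span_step.hyps(1) by (simp add: V.M.a_lcomm)
        ultimately show ?thesis using \<mu> by blast
      next
        case 2
        have "y \<in> below Y (rank Y \<nu>)"
          unfolding y using min[OF 2] z below_mono[of "rank Y \<mu>" "rank Y \<nu>" Y] 2 \<mu>(3) sub(4,5)
          by (meson less_imp_le subsetD)
        then show ?thesis using \<nu> span_step.hyps(1) by blast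
      next
        case 3
        then have "\<nu> = \<mu>" using rank_inj[OF Y] \<nu>(1) \<mu>(1) by (auto dest: inj_onD)
        then have "b \<odot>\<^bsub>Val M Y\<^esub> g \<oplus>\<^bsub>Val M Y\<^esub> y = (b \<oplus>\<^bsub>k\<^esub> a) \<odot>\<^bsub>Val M Y\<^esub> monomial_elem Y \<mu> \<oplus>\<^bsub>Val M Y\<^esub> z"
          unfolding y \<nu>(3) using m zc \<mu>(3) span_step.hyps(1)
          by (simp add: V.smult_l_distr V.M.a_assoc)
        moreover have "b \<oplus>\<^bsub>k\<^esub> a \<in> carrier k" using \<mu>(3) span_step.hyps(1) by simp
        ultimately show ?thesis using \<mu> z by blast
      qed
    qed
  qed
  then show thesis using y(2) that by blast
qed

text \<open>Every generator index is less than \<open>r\<close>, so the rank \<open>(r, w)\<close> exceeds the ranks of all monomials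
  whatever \<open>w\<close> is.\<close>

lemma carrier_eq_below:
  assumes gen: "\<And>Y. Y \<in> Obj C \<Longrightarrow>
      generated_submodule C k M ((\<lambda>t. (G t, x t)) ` {..<r}) Y = carrier (Val M Y)"
    and Y: "Y \<in> Obj C"
  shows "carrier (Val M Y) = below Y (r, w)"
proof -
  have all: "{\<mu> \<in> monomials Y. rank Y \<mu> < (r, w)} = monomials Y" for Y
    by (auto simp: monomials_def rank_def)
  have "cat_submodule C k M (\<lambda>Y. below Y (r, w))"
    unfolding cat_submodule_def
  proof (intro conjI ballI)
    fix Y Z g y assume YZ: "Y \<in> Obj C" "Z \<in> Obj C" "g \<in> Mor C Y Z" and y: "y \<in> below Y (r, w)"
    show "Act M Y Z g y \<in> below Z (r, w)"
      unfolding below_def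
      by (rule linear_map_module_span[OF Val_module[OF YZ(1)] Val_module[OF YZ(2)]
            Act_linear[OF YZ] monomial_elem_set_carrier[OF YZ(1)] y[unfolded below_def]])
        (use push_monomial[OF YZ] all in auto)
  qed (rule below_submodule)
  moreover have "y \<in> below Z (r, w)" if mem: "(Z, y) \<in> (\<lambda>t. (G t, x t)) ` {..<r}" for Z y
  proof -
    obtain t where t: "t < r" "Z = G t" "y = x t" using mem by auto
    have "(t, Ident C (G t)) \<in> monomials (G t)"
      using t Ident_closed[OF G_Obj] by (simp add: monomials_def)
    moreover have "monomial_elem (G t) (t, Ident C (G t)) = x t"
      using t Act_Ident[OF G_Obj x_carrier] by (simp add: monomial_elem_def)
    ultimately have "x t \<in> monomial_elem (G t) ` {\<mu> \<in> monomials (G t). rank (G t) \<mu> < (r, w)}"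
      unfolding all by force
    then show ?thesis
      unfolding below_def t
      using module.module_span_incl[OF Val_module monomial_elem_set_carrier] G_Obj t by blast
  qed
  ultimately have "carrier (Val M Y) \<subseteq> below Y (r, w)"
    using generated_submodule_minimal[of "\<lambda>Y. below Y (r, w)"] gen[OF Y] by blast
  moreover have "below Y (r, w) \<subseteq> carrier (Val M Y)"
    using module.submoduleE(1)[OF Val_module below_submodule] Y by blast
  ultimately show ?thesis by blast
qed

text \<open>The coefficients with which a monomial leads some element of a submodule form an ideal. It is
  through this ideal that the Noetherian hypothesis on the coefficient ring enters.\<close>

lemma leading_coeffs_ideal:
  assumes Y: "Y \<in> Obj C" and \<mu>: "\<mu> \<in> monomials Y" and P: "submodule P k (Val M Y)"
  shows "ideal {b \<in> carrier k. \<exists>z\<in>below Y (rank Y \<mu>). b \<odot>\<^bsub>Val M Y\<^esub> monomial_elem Y \<mu> \<oplus>\<^bsub>Val M Y\<^esub> z \<in> P} k"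
    (is "ideal ?J k")
proof -
  interpret V: module k "Val M Y" using Y by (rule Val_module)
  note B = V.submoduleE[OF below_submodule[OF Y, of "rank Y \<mu>"]]
  note P = V.submoduleE[OF P]
  have m: "monomial_elem Y \<mu> \<in> carrier (Val M Y)" using monomial_elem_carrier Y \<mu> by blast
  have zero: "\<zero>\<^bsub>k\<^esub> \<in> ?J"
  proof -
    have "\<zero>\<^bsub>Val M Y\<^esub> \<in> P"
      using V.module_span_minimal[OF assms(3), of "{}"] span_zero by blast
    moreover have "\<zero>\<^bsub>Val M Y\<^esub> \<in> below Y (rank Y \<mu>)" unfolding below_def by (rule span_zero)
    ultimately show ?thesis using m by force
  qed
  have add: "a \<oplus>\<^bsub>k\<^esub> b \<in> ?J" if ab: "a \<in> ?J" "b \<in> ?J" for a b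
  proof -
    obtain y z where yz: "y \<in> below Y (rank Y \<mu>)" "z \<in> below Y (rank Y \<mu>)"
      "a \<odot>\<^bsub>Val M Y\<^esub> monomial_elem Y \<mu> \<oplus>\<^bsub>Val M Y\<^esub> y \<in> P" "b \<odot>\<^bsub>Val M Y\<^esub> monomial_elem Y \<mu> \<oplus>\<^bsub>Val M Y\<^esub> z \<in> P"
      using ab by blast
    have "(a \<odot>\<^bsub>Val M Y\<^esub> monomial_elem Y \<mu> \<oplus>\<^bsub>Val M Y\<^esub> y) \<oplus>\<^bsub>Val M Y\<^esub> (b \<odot>\<^bsub>Val M Y\<^esub> monomial_elem Y \<mu> \<oplus>\<^bsub>Val M Y\<^esub> z)
        = (a \<oplus>\<^bsub>k\<^esub> b) \<odot>\<^bsub>Val M Y\<^esub> monomial_elem Y \<mu> \<oplus>\<^bsub>Val M Y\<^esub> (y \<oplus>\<^bsub>Val M Y\<^esub> z)"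
      using ab yz(1,2) B(1) m by (simp add: V.smult_l_distr V.M.add.m_ac subset_iff)
    then show ?thesis using P(5)[OF yz(3,4)] B(5)[OF yz(1,2)] ab by auto
  qed
  have mult: "c \<otimes>\<^bsub>k\<^esub> b \<in> ?J" if c: "c \<in> carrier k" and b: "b \<in> ?J" for b c
  proof -
    obtain z where z: "z \<in> below Y (rank Y \<mu>)" "b \<odot>\<^bsub>Val M Y\<^esub> monomial_elem Y \<mu> \<oplus>\<^bsub>Val M Y\<^esub> z \<in> P"
      using b by blast
    have "c \<odot>\<^bsub>Val M Y\<^esub> (b \<odot>\<^bsub>Val M Y\<^esub> monomial_elem Y \<mu> \<oplus>\<^bsub>Val M Y\<^esub> z)
        = (c \<otimes>\<^bsub>k\<^esub> b) \<odot>\<^bsub>Val M Y\<^esub> monomial_elem Y \<mu> \<oplus>\<^bsub>Val M Y\<^esub> c \<odot>\<^bsub>Val M Y\<^esub> z"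
      using c b z(1) B(1) m by (simp add: V.smult_r_distr V.smult_assoc1 subset_iff)
    then show ?thesis using P(4)[OF c z(2)] B(4)[OF c z(1)] b c by auto
  qed
  have neg: "\<ominus>\<^bsub>k\<^esub> b \<in> ?J" if b: "b \<in> ?J" for b
    using mult[OF _ b, of "\<ominus>\<^bsub>k\<^esub> \<one>\<^bsub>k\<^esub>"] b l_minus[of "\<one>\<^bsub>k\<^esub>" b] by simp
  show ?thesis
  proof (rule idealI[OF ring_axioms])
    show "subgroup ?J (add_monoid k)"
      by (rule add.subgroupI) (use zero neg add in \<open>auto simp: a_inv_def[symmetric]\<close>)
    show "c \<otimes>\<^bsub>k\<^esub> b \<in> ?J" if "b \<in> ?J" "c \<in> carrier k" for b c using mult that by blast
    then show "b \<otimes>\<^bsub>k\<^esub> c \<in> ?J" if "b \<in> ?J" "c \<in> carrier k" for b c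
      using that m_comm[of b c] by (metis (no_types, lifting) mem_Collect_eq)
  qed
qed

text \<open>Take the lowest level of the filtration at which \<open>P\<close> has an element outside \<open>Q\<close>. Whatever lies
  strictly below its leading monomial already belongs to \<open>Q\<close>.\<close>

lemma new_leading_monomial:
  assumes gen: "\<And>Y. Y \<in> Obj C \<Longrightarrow>
      generated_submodule C k M ((\<lambda>t. (G t, x t)) ` {..<r}) Y = carrier (Val M Y)"
    and Y: "Y \<in> Obj C" and P: "submodule P k (Val M Y)" and Q: "submodule Q k (Val M Y)"
    and new: "\<not> P \<subseteq> Q"
  obtains y \<mu> a z where "y \<in> P" "y \<notin> Q" "\<mu> \<in> monomials Y" "a \<in> carrier k" "z \<in> below Y (rank Y \<mu>)"
    and "y = a \<odot>\<^bsub>Val M Y\<^esub> monomial_elem Y \<mu> \<oplus>\<^bsub>Val M Y\<^esub> z" and "P \<inter> below Y (rank Y \<mu>) \<subseteq> Q"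
proof -
  interpret V: module k "Val M Y" using Y by (rule Val_module)
  define \<rho> where "\<rho> = (LEAST \<rho>. \<exists>y. y \<in> P \<inter> below Y \<rho> \<and> y \<notin> Q)"
  \<comment> \<open>the second component has no influence: all generator indices are less than \<open>r\<close>\<close>
  have "P \<subseteq> below Y (r, undefined)"
    using V.submoduleE(1)[OF P] carrier_eq_below[OF gen Y] by simp
  then have ex: "\<exists>\<rho> y. y \<in> P \<inter> below Y \<rho> \<and> y \<notin> Q" using new by blast
  obtain y where y: "y \<in> P" "y \<in> below Y \<rho>" "y \<notin> Q"
    using LeastI_ex[OF ex] unfolding \<rho>_def by blast
  have min: "P \<inter> below Y \<sigma> \<subseteq> Q" if "\<sigma> < \<rho>" for \<sigma>
    using not_less_Least[OF that[unfolded \<rho>_def]] by blast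
  have "\<zero>\<^bsub>Val M Y\<^esub> \<in> Q"
    using V.module_span_minimal[OF Q, of "{}"] span_zero by blast
  then have "y \<noteq> \<zero>\<^bsub>Val M Y\<^esub>" using y by blast
  then obtain \<mu> a z where \<mu>: "\<mu> \<in> monomials Y" "rank Y \<mu> < \<rho>" "a \<in> carrier k" "z \<in> below Y (rank Y \<mu>)"
    "y = a \<odot>\<^bsub>Val M Y\<^esub> monomial_elem Y \<mu> \<oplus>\<^bsub>Val M Y\<^esub> z"
    by (rule leading_monomial[OF Y y(2)])
  show thesis by (rule that[OF y(1,3) \<mu>(1,3,4,5) min[OF \<mu>(2)]])
qed

text \<open>Hilbert's basis argument. If \<open>N\<close> were not finitely generated, one could choose forever an
  element outside the submodule generated by the earlier choices, each time with a least possible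
  leading monomial. Along a subsequence every leading monomial divides all later ones, and by the
  Noetherian property one of the leading coefficients lies in the ideal generated by the earlier
  ones. Transporting the earlier elements and combining them produces an element of the generated
  submodule with the same leading term as the new one. The difference has no term as large, so it
  was generated before by minimality, and hence so was the new element.\<close>

proposition submodule_generators:
  assumes noeth: "noetherian_ring k"
    and good: "\<And>t Y f. \<lbrakk>t < r; \<And>i::nat. Y i \<in> Obj C; \<And>i. f i \<in> Mor C (G t) (Y i)\<rbrakk>
      \<Longrightarrow> \<exists>i j. i < j \<and> dominates C rk (G t) (Y i) (f i) (Y j) (f j)"
    and gen: "\<And>Y. Y \<in> Obj C \<Longrightarrow>
      generated_submodule C k M ((\<lambda>t. (G t, x t)) ` {..<r}) Y = carrier (Val M Y)"
    and N: "cat_submodule C k M N"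
  obtains S where "finite S" "S \<subseteq> (SIGMA Y:Obj C. N Y)"
    and "\<And>Y. Y \<in> Obj C \<Longrightarrow> N Y \<subseteq> generated_submodule C k M S Y"
proof (rule ccontr)
  note conclude = that
  assume neg: "\<not> thesis"
  let ?gen = "generated_submodule C k M"
  have N_sub: "submodule (N Y) k (Val M Y)" if "Y \<in> Obj C" for Y
    using N that by (simp add: cat_submodule_def)
  have N_carrier: "N Y \<subseteq> carrier (Val M Y)" if "Y \<in> Obj C" for Y
    using module.submoduleE(1)[OF Val_module N_sub] that by blast
  have gen_sub: "cat_submodule C k M (?gen S)" if "S \<subseteq> (SIGMA Y:Obj C. N Y)" for S
    using that N_carrier by (intro generated_submodule_is_submodule) blast
  have gen_sub_at: "submodule (?gen S Y) k (Val M Y)"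
    if "S \<subseteq> (SIGMA Y:Obj C. N Y)" "Y \<in> Obj C" for S Y
    using gen_sub[OF that(1)] that(2) by (simp add: cat_submodule_def)
  \<comment> \<open>\<open>e\<close>: object, new element, leading monomial, leading coefficient; \<open>S\<close>: the earlier elements\<close>
  define step where "step S e \<longleftrightarrow> (case e of (Y, y, \<mu>, a) \<Rightarrow>
      Y \<in> Obj C \<and> y \<in> N Y \<and> y \<notin> ?gen S Y \<and> \<mu> \<in> monomials Y \<and> a \<in> carrier k \<and>
      (\<exists>z\<in>below Y (rank Y \<mu>). y = a \<odot>\<^bsub>Val M Y\<^esub> monomial_elem Y \<mu> \<oplus>\<^bsub>Val M Y\<^esub> z) \<and>
      N Y \<inter> below Y (rank Y \<mu>) \<subseteq> ?gen S Y)"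
    for S and e :: "'o \<times> 'm \<times> (nat \<times> 'f) \<times> 'k"
  define pt where "pt e = (fst e, fst (snd e))" for e :: "'o \<times> 'm \<times> (nat \<times> 'f) \<times> 'k"
  have "\<exists>F. \<forall>i::nat. step ((\<lambda>j. pt (F j)) ` {..<i}) (F i)"
  proof (rule dependent_wellorder_choice)
    fix e and F F' :: "nat \<Rightarrow> 'o \<times> 'm \<times> (nat \<times> 'f) \<times> 'k" and i :: nat
    assume "\<And>j. j < i \<Longrightarrow> F j = F' j"
    then have "(\<lambda>j. pt (F j)) ` {..<i} = (\<lambda>j. pt (F' j)) ` {..<i}" by auto
    then show "step ((\<lambda>j. pt (F j)) ` {..<i}) e = step ((\<lambda>j. pt (F' j)) ` {..<i}) e" by simp
  next
    fix i :: nat and F :: "nat \<Rightarrow> 'o \<times> 'm \<times> (nat \<times> 'f) \<times> 'k"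
    assume prev: "\<And>j. j < i \<Longrightarrow> step ((\<lambda>j. pt (F j)) ` {..<j}) (F j)"
    let ?S = "(\<lambda>j. pt (F j)) ` {..<i}"
    have "pt (F j) \<in> (SIGMA Y:Obj C. N Y)" if "j < i" for j
      using prev[OF that] by (auto simp: step_def pt_def split: prod.splits)
    then have S: "?S \<subseteq> (SIGMA Y:Obj C. N Y)" by blast
    then obtain Y where Y: "Y \<in> Obj C" "\<not> N Y \<subseteq> ?gen ?S Y"
      using neg conclude[of ?S] by blast
    obtain y \<mu> a z where "y \<in> N Y" "y \<notin> ?gen ?S Y" "\<mu> \<in> monomials Y" "a \<in> carrier k"
      "z \<in> below Y (rank Y \<mu>)" "y = a \<odot>\<^bsub>Val M Y\<^esub> monomial_elem Y \<mu> \<oplus>\<^bsub>Val M Y\<^esub> z"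
      "N Y \<inter> below Y (rank Y \<mu>) \<subseteq> ?gen ?S Y"
      by (rule new_leading_monomial[OF gen Y(1) N_sub[OF Y(1)] gen_sub_at[OF S Y(1)] Y(2)])
    then have "step ?S (Y, y, \<mu>, a)" using Y(1) by (auto simp: step_def)
    then show "\<exists>e. step ?S e" ..
  qed
  then obtain F where F: "\<And>i::nat. step ((\<lambda>j. pt (F j)) ` {..<i}) (F i)" by blast
  define Y y t f a where "Y i = fst (F i)" and "y i = fst (snd (F i))"
    and "t i = fst (fst (snd (snd (F i))))" and "f i = snd (fst (snd (snd (F i))))"
    and "a i = snd (snd (snd (F i)))" for i :: nat
  define S where "S i = (\<lambda>j. pt (F j)) ` {..<i}" for i :: nat
  have "F i = (Y i, y i, (t i, f i), a i)" for i
    by (simp add: Y_def y_def t_def f_def a_def)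
  with F have "step (S i) (Y i, y i, (t i, f i), a i)" for i unfolding S_def by metis
  then have Y: "Y i \<in> Obj C" and yN: "y i \<in> N (Y i)" and y_new: "y i \<notin> ?gen (S i) (Y i)"
    and \<mu>: "(t i, f i) \<in> monomials (Y i)" and a: "a i \<in> carrier k"
    and lead: "\<exists>z\<in>below (Y i) (rank (Y i) (t i, f i)).
        y i = a i \<odot>\<^bsub>Val M (Y i)\<^esub> monomial_elem (Y i) (t i, f i) \<oplus>\<^bsub>Val M (Y i)\<^esub> z"
    and min: "N (Y i) \<inter> below (Y i) (rank (Y i) (t i, f i)) \<subseteq> ?gen (S i) (Y i)" for i
    by (simp_all add: step_def)
  have t: "t i < r" and f: "f i \<in> Mor C (G (t i)) (Y i)" for i
    using \<mu>[of i] by (simp_all add: monomials_def)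
  have S_mem: "(Y j, y j) \<in> S i" if "j < i" for i j
    using that by (auto simp: S_def pt_def Y_def y_def)
  have SN: "S i \<subseteq> (SIGMA Y:Obj C. N Y)" for i
    using Y yN by (auto simp: S_def pt_def Y_def[symmetric] y_def[symmetric])
  define rel where "rel i j \<longleftrightarrow>
      t i = t j \<and> dominates C rk (G (t i)) (Y i) (f i) (Y j) (f j)" for i j
  \<comment> \<open>finitely many generators, so infinitely many leading monomials share their generator\<close>
  obtain \<phi> :: "nat \<Rightarrow> nat" where \<phi>: "strict_mono \<phi>" and perfect: "\<And>i j. i < j \<Longrightarrow> rel (\<phi> i) (\<phi> j)"
  proof (rule good_imp_perfect_subsequence[of rel])
    fix \<psi> :: "nat \<Rightarrow> nat" assume \<psi>: "strict_mono \<psi>"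
    have "finite (range (\<lambda>i. t (\<psi> i)))" by (rule finite_subset[of _ "{..<r}"]) (use t in auto)
    then obtain i0 where inf: "infinite {i. t (\<psi> i) = t (\<psi> i0)}"
      using pigeonhole_infinite[of UNIV "\<lambda>i. t (\<psi> i)"] by auto
    define e where "e = enumerate {i. t (\<psi> i) = t (\<psi> i0)}"
    have e: "t (\<psi> (e i)) = t (\<psi> i0)" for i
      using enumerate_in_set[OF inf, of i] by (simp add: e_def)
    have e_less: "e i < e j" if "i < j" for i j
      using enumerate_mono[OF that inf] by (simp add: e_def)
    obtain i j where ij: "i < j" "dominates C rk (G (t (\<psi> i0))) (Y (\<psi> (e i))) (f (\<psi> (e i)))
        (Y (\<psi> (e j))) (f (\<psi> (e j)))"
      using good[OF t, of "\<lambda>i. Y (\<psi> (e i))" "\<lambda>i. f (\<psi> (e i))" "\<psi> i0"] Y f e by metis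
    then have "rel (\<psi> (e i)) (\<psi> (e j))" by (simp add: rel_def e)
    then show "\<exists>i j. i < j \<and> rel (\<psi> i) (\<psi> j)" using e_less[OF ij(1)] by blast
  qed blast
  obtain j where j: "a (\<phi> j) \<in> Idl\<^bsub>k\<^esub> ((\<lambda>i. a (\<phi> i)) ` {..<j})"
    using noetherian_ring.sequence_in_earlier_ideal[OF noeth, of "\<lambda>i. a (\<phi> i)"] a by blast
  let ?n = "\<phi> j"
  let ?Y = "Y ?n" and ?\<mu> = "(t ?n, f ?n)"
  interpret V: module k "Val M ?Y" by (rule Val_module[OF Y])
  let ?P = "?gen (S ?n) ?Y" and ?B = "below ?Y (rank ?Y ?\<mu>)"
  have P: "submodule ?P k (Val M ?Y)" by (rule gen_sub_at[OF SN Y])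
  have B: "submodule ?B k (Val M ?Y)" by (rule below_submodule[OF Y])
  \<comment> \<open>leading coefficients at the new monomial of what has been generated so far\<close>
  let ?J = "{b \<in> carrier k. \<exists>z\<in>?B. b \<odot>\<^bsub>Val M ?Y\<^esub> monomial_elem ?Y ?\<mu> \<oplus>\<^bsub>Val M ?Y\<^esub> z \<in> ?P}"
  have "a (\<phi> i) \<in> ?J" if ij: "i < j" for i
  proof -
    let ?m = "\<phi> i"
    have mn: "?m < ?n" using \<phi> ij by (simp add: strict_mono_def)
    have eq: "t ?m = t ?n" using perfect[OF ij] by (simp add: rel_def)
    have "dominates C rk (G (t ?n)) (Y ?m) (f ?m) ?Y (f ?n)"
      using perfect[OF ij] unfolding rel_def by metis
    then obtain g where g: "g \<in> Mor C (Y ?m) ?Y"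
      and comp: "Comp C (G (t ?n)) (Y ?m) ?Y g (f ?m) = f ?n"
      and mono: "\<And>f'. \<lbrakk>f' \<in> Mor C (G (t ?n)) (Y ?m);
          rk (G (t ?n)) (Y ?m) f' < rk (G (t ?n)) (Y ?m) (f ?m)\<rbrakk>
        \<Longrightarrow> rk (G (t ?n)) ?Y (Comp C (G (t ?n)) (Y ?m) ?Y g f') < rk (G (t ?n)) ?Y (f ?n)"
      unfolding dominates_def by auto
    obtain z where z: "z \<in> below (Y ?m) (rank (Y ?m) (t ?m, f ?m))"
      and y: "y ?m = a ?m \<odot>\<^bsub>Val M (Y ?m)\<^esub> monomial_elem (Y ?m) (t ?m, f ?m) \<oplus>\<^bsub>Val M (Y ?m)\<^esub> z"
      using lead by blast
    interpret U: module k "Val M (Y ?m)" by (rule Val_module[OF Y])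
    have zc: "z \<in> carrier (Val M (Y ?m))"
      using z U.submoduleE(1)[OF below_submodule[OF Y]] by blast
    have "Act M (Y ?m) ?Y g (y ?m) = a ?m \<odot>\<^bsub>Val M ?Y\<^esub> Act M (Y ?m) ?Y g (monomial_elem (Y ?m) (t ?m, f ?m))
        \<oplus>\<^bsub>Val M ?Y\<^esub> Act M (Y ?m) ?Y g z"
      using Act_linear[OF Y Y g] monomial_elem_carrier[OF Y \<mu>] zc a by (simp add: y linear_map_def)
    also have "Act M (Y ?m) ?Y g (monomial_elem (Y ?m) (t ?m, f ?m)) = monomial_elem ?Y ?\<mu>"
      using push_monomial(2)[OF Y Y g \<mu>] by (simp add: push_def comp eq)
    finally have "Act M (Y ?m) ?Y g (y ?m)
      = a ?m \<odot>\<^bsub>Val M ?Y\<^esub> monomial_elem ?Y ?\<mu> \<oplus>\<^bsub>Val M ?Y\<^esub> Act M (Y ?m) ?Y g z" .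
    moreover have "Act M (Y ?m) ?Y g (y ?m) \<in> ?P"
      using gen_sub[OF SN, of ?n] generated_submodule_incl[OF S_mem[OF mn]] Y g
      by (simp add: cat_submodule_def)
    moreover have "Act M (Y ?m) ?Y g z \<in> ?B"
      by (rule Act_below[OF Y Y g mono z[unfolded eq]])
    ultimately show ?thesis using a by auto
  qed
  then have "Idl\<^bsub>k\<^esub> ((\<lambda>i. a (\<phi> i)) ` {..<j}) \<subseteq> ?J"
    by (intro genideal_minimal leading_coeffs_ideal Y \<mu> P) blast
  with j obtain z' where z': "z' \<in> ?B" "a ?n \<odot>\<^bsub>Val M ?Y\<^esub> monomial_elem ?Y ?\<mu> \<oplus>\<^bsub>Val M ?Y\<^esub> z' \<in> ?P" by blast
  obtain z where z: "z \<in> ?B" "y ?n = a ?n \<odot>\<^bsub>Val M ?Y\<^esub> monomial_elem ?Y ?\<mu> \<oplus>\<^bsub>Val M ?Y\<^esub> z"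
    using lead by blast
  let ?y' = "a ?n \<odot>\<^bsub>Val M ?Y\<^esub> monomial_elem ?Y ?\<mu> \<oplus>\<^bsub>Val M ?Y\<^esub> z'"
  let ?d = "z \<oplus>\<^bsub>Val M ?Y\<^esub> \<ominus>\<^bsub>Val M ?Y\<^esub> z'"
  have c: "monomial_elem ?Y ?\<mu> \<in> carrier (Val M ?Y)" "z \<in> carrier (Val M ?Y)" "z' \<in> carrier (Val M ?Y)"
    using monomial_elem_carrier[OF Y \<mu>] z(1) z'(1) V.submoduleE(1)[OF B] by blast+
  have y'c: "?y' \<in> carrier (Val M ?Y)" using c a by simp
  have d: "y ?n \<oplus>\<^bsub>Val M ?Y\<^esub> \<ominus>\<^bsub>Val M ?Y\<^esub> ?y' = ?d"
    unfolding z(2) using c a[of ?n]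
    by (simp add: V.M.minus_add V.M.add.m_ac V.M.r_neg1 V.M.r_neg2 V.M.l_neg V.M.r_neg)
  have "y ?n \<in> carrier (Val M ?Y)" unfolding z(2) using c a by simp
  then have y_eq: "?d \<oplus>\<^bsub>Val M ?Y\<^esub> ?y' = y ?n"
    unfolding d[symmetric] using y'c by (simp add: V.M.a_assoc V.M.l_neg)
  have "?gen (S ?n) ?Y \<subseteq> N ?Y"
    using SN by (intro generated_submodule_minimal[OF N]) blast
  then have "?y' \<in> N ?Y" using z'(2) by blast
  then have "?d \<in> N ?Y"
    unfolding d[symmetric] using yN V.submoduleE(3,5)[OF N_sub[OF Y]] by blast
  moreover have "?d \<in> ?B" using z(1) z'(1) V.submoduleE(3,5)[OF B] by blast
  ultimately have "?d \<in> ?P" using min by blast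
  then have "y ?n \<in> ?P" unfolding y_eq[symmetric] using z'(2) V.submoduleE(5)[OF P] by blast
  then show False using y_new by blast
qed

end

text \<open>The hypotheses say that each principal projective functor \<open>k[Hom(X, -)]\<close> has a Groebner theory:
  \<open>rk\<close> is an admissible well-order on its monomials, and divisibility of monomials admits no
  infinite bad sequence.\<close>

theorem groebner_criterion:
  fixes C :: "('o, 'f) category" and rk :: "'o \<Rightarrow> 'o \<Rightarrow> 'f \<Rightarrow> 'w::wellorder"
  assumes inj: "\<And>X Y. \<lbrakk>X \<in> Obj C; Y \<in> Obj C\<rbrakk> \<Longrightarrow> inj_on (rk X Y) (Mor C X Y)"
    and good: "\<And>X Y f. \<lbrakk>X \<in> Obj C; \<And>i::nat. Y i \<in> Obj C; \<And>i. f i \<in> Mor C X (Y i)\<rbrakk>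
      \<Longrightarrow> \<exists>i j. i < j \<and> dominates C rk X (Y i) (f i) (Y j) (f j)"
  shows "locally_noetherian C TYPE('k) TYPE('m)"
  unfolding locally_noetherian_def locally_noetherian_over_def
proof (intro allI impI)
  fix k :: "'k ring" and M :: "('o, 'f, 'k, 'm) cat_mod" and N
  assume noeth: "noetherian_ring k" and "cat_module C k M"
    and fg: "finitely_generated C k M" and N: "cat_submodule C k M N"
  interpret cat_module C k M by fact
  obtain S where S: "finite S" "S \<subseteq> (SIGMA X:Obj C. carrier (Val M X))"
    "\<And>X. X \<in> Obj C \<Longrightarrow> generated_submodule C k M S X = carrier (Val M X)"
    using fg unfolding finitely_generated_def by blast
  obtain xs where xs: "set xs = S" using finite_list[OF S(1)] by blast
  define G x where "G t = fst (xs ! t)" and "x t = snd (xs ! t)" for t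
  have mem: "(G t, x t) \<in> S" if "t < length xs" for t
    using nth_mem[OF that] xs by (simp add: G_def x_def)
  have img: "(\<lambda>t. (G t, x t)) ` {..<length xs} = S"
    unfolding xs[symmetric] set_conv_nth by (auto simp: G_def x_def)
  interpret ranked_generators C k M rk "length xs" G x
    by unfold_locales (use mem S(2) inj in auto)
  obtain T where "finite T" "T \<subseteq> (SIGMA Y:Obj C. N Y)"
    "\<And>Y. Y \<in> Obj C \<Longrightarrow> N Y \<subseteq> generated_submodule C k M T Y"
    by (rule submodule_generators[OF noeth _ _ N]) (use good G_Obj S(3) img in auto)
  then show "finitely_generated C k (submodule_cat_mod M N)"
    by (rule finitely_generated_submoduleI[OF N])
qed

section \<open>Higman's lemma for a finite alphabet\<close>

definition bad_seq :: "'a set \<Rightarrow> (nat \<Rightarrow> 'a list) \<Rightarrow> bool" where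
  "bad_seq A f \<longleftrightarrow> (\<forall>i. set (f i) \<subseteq> A) \<and> (\<forall>i j. i < j \<longrightarrow> \<not> subseq (f i) (f j))"

text \<open>The sequence is built greedily: each term is as short as it can be among the bad sequences
  that share all earlier terms.\<close>

lemma minimal_bad_seq:
  assumes "bad_seq A f0"
  obtains g where "bad_seq A g"
    and "\<And>h i. \<lbrakk>bad_seq A h; \<And>j. j < i \<Longrightarrow> h j = g j\<rbrakk> \<Longrightarrow> length (g i) \<le> length (h i)"
proof -
  define P where "P g i x \<longleftrightarrow>
      (\<exists>h. bad_seq A h \<and> (\<forall>j<i. h j = g j) \<and> h i = x) \<and>
      (\<forall>h. bad_seq A h \<longrightarrow> (\<forall>j<i. h j = g j) \<longrightarrow> length x \<le> length (h i))"
    for g :: "nat \<Rightarrow> 'a list" and i :: nat and x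
  have "\<exists>g. \<forall>i. P g i (g i)"
  proof (rule dependent_wellorder_choice)
    fix r and f g :: "nat \<Rightarrow> 'a list" and i :: nat
    assume "\<And>j. j < i \<Longrightarrow> f j = g j"
    then show "P f i r = P g i r" by (simp add: P_def)
  next
    fix i :: nat and f :: "nat \<Rightarrow> 'a list"
    assume prev: "\<And>j. j < i \<Longrightarrow> P f j (f j)"
    have "\<exists>h. bad_seq A h \<and> (\<forall>j<i. h j = f j)"
    proof (cases i)
      case 0
      then show ?thesis using assms by blast
    next
      case (Suc m)
      then obtain h where "bad_seq A h" "\<forall>j<m. h j = f j" "h m = f m"
        using prev[of m] by (auto simp: P_def)
      then show ?thesis using Suc less_Suc_eq by blast
    qed
    then obtain h where h: "bad_seq A h \<and> (\<forall>j<i. h j = f j)" 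
      and hmin: "\<And>h'. bad_seq A h' \<and> (\<forall>j<i. h' j = f j) \<Longrightarrow> length (h i) \<le> length (h' i)"
      using ex_has_least_nat[of "\<lambda>h. bad_seq A h \<and> (\<forall>j<i. h j = f j)" _ "\<lambda>h. length (h i)"]
      by blast
    then have "P f i (h i)" by (auto simp: P_def)
    then show "\<exists>r. P f i r" ..
  qed
  then obtain g where g: "\<And>i. P g i (g i)" by blast
  have "bad_seq A g"
    unfolding bad_seq_def
  proof (intro conjI allI impI)
    fix i show "set (g i) \<subseteq> A"
      using g[of i] by (metis P_def bad_seq_def)
  next
    fix i j :: nat assume "i < j"
    then show "\<not> subseq (g i) (g j)"
      using g[of j] by (metis P_def bad_seq_def)
  qed
  moreover have "length (g i) \<le> length (h i)" 
    if "bad_seq A h" "\<And>j. j < i \<Longrightarrow> h j = g j" for h i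
    using g[of i] that by (simp add: P_def)
  ultimately show thesis by (rule that)
qed

text \<open>In a minimal bad sequence infinitely many words start with the same letter. Replacing the
  sequence from the first of these words on by their tails gives a bad sequence again, which is
  shorter.\<close>

theorem higman:
  fixes f :: "nat \<Rightarrow> 'a list"
  assumes "finite A" and "\<And>i. set (f i) \<subseteq> A"
  obtains i j where "i < j" and "subseq (f i) (f j)"
proof (rule ccontr)
  assume "\<not> thesis"
  then have "bad_seq A f" using assms(2) that by (auto simp: bad_seq_def)
  then obtain g where bad: "bad_seq A g"
    and min: "\<And>h i. \<lbrakk>bad_seq A h; \<And>j. j < i \<Longrightarrow> h j = g j\<rbrakk> \<Longrightarrow> length (g i) \<le> length (h i)"
    by (rule minimal_bad_seq) blast
  have gA: "set (g i) \<subseteq> A" for i using bad by (simp add: bad_seq_def)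
  have gbad: "\<not> subseq (g i) (g j)" if "i < j" for i j using bad that by (simp add: bad_seq_def)
  have ne: "g i \<noteq> []" for i using gbad[of i "Suc i"] by auto
  have "range (hd \<circ> g) \<subseteq> A" using ne gA hd_in_set by fastforce
  then have "finite (range (hd \<circ> g))" using assms(1) finite_subset by blast
  then obtain i0 where inf: "infinite {i. hd (g i) = hd (g i0)}"
    using pigeonhole_infinite[of UNIV "hd \<circ> g"] by auto
  let ?I = "{i. hd (g i) = hd (g i0)}"
  define \<phi> where "\<phi> = enumerate ?I"
  have \<phi>: "hd (g (\<phi> n)) = hd (g i0)" for n
    using enumerate_in_set[OF inf, of n] by (simp add: \<phi>_def)
  have \<phi>_less: "\<phi> m < \<phi> n" if "m < n" for m n
    using enumerate_mono[OF that inf] by (simp add: \<phi>_def)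
  have \<phi>0: "\<phi> 0 \<le> \<phi> n" for n using \<phi>_less[of 0 n] by (cases n) (auto simp: less_imp_le)
  define h where "h i = (if i < \<phi> 0 then g i else tl (g (\<phi> (i - \<phi> 0))))" for i
  have "bad_seq A h"
    unfolding bad_seq_def
  proof (intro conjI allI impI)
    fix i show "set (h i) \<subseteq> A"
      using gA ne by (auto simp: h_def dest: list.set_sel(2)[rotated])
  next
    fix i j :: nat assume ij: "i < j"
    consider "j < \<phi> 0" | "i < \<phi> 0" "\<not> j < \<phi> 0" | "\<not> i < \<phi> 0" "\<not> j < \<phi> 0" using ij by linarith
    then show "\<not> subseq (h i) (h j)"
    proof cases
      case 1
      then show ?thesis using ij gbad by (simp add: h_def)
    next
      case 2
      let ?k = "\<phi> (j - \<phi> 0)"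
      have "i < ?k" using 2 \<phi>0[of "j - \<phi> 0"] by linarith
      moreover have "subseq (tl (g ?k)) (g ?k)" using ne[of ?k] by (cases "g ?k") auto
      ultimately show ?thesis using 2 gbad subseq_order.order_trans[of "g i" "tl (g ?k)" "g ?k"] by (auto simp: h_def)
    next
      case 3
      let ?k = "\<phi> (i - \<phi> 0)" and ?l = "\<phi> (j - \<phi> 0)"
      have "?k < ?l" using 3 ij by (intro \<phi>_less) linarith
      then have "\<not> subseq (g ?k) (g ?l)" by (rule gbad)
      moreover have "g ?k = hd (g i0) # tl (g ?k)" "g ?l = hd (g i0) # tl (g ?l)"
        using \<phi> ne by (metis list.collapse)+
      ultimately show ?thesis using 3 by (metis h_def subseq_Cons2)
    qed
  qed
  then have "length (g (\<phi> 0)) \<le> length (h (\<phi> 0))" by (rule min) (simp add: h_def)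
  then show False using ne[of "\<phi> 0"] by (cases "g (\<phi> 0)") (simp_all add: h_def)
qed

lemma subseq_index_embedding:
  assumes "subseq u w"
  obtains e where "strict_mono_on {..<length u} e"
    and "\<And>i. i < length u \<Longrightarrow> e i < length w \<and> w ! e i = u ! i"
proof -
  have "\<exists>e. strict_mono_on {..<length u} e \<and> (\<forall>i<length u. e i < length w \<and> w ! e i = u ! i)"
    using assms
  proof (induction rule: list_emb.induct)
    case (list_emb_Nil ys)
    then show ?case by (auto simp: strict_mono_on_def)
  next
    case (list_emb_Cons xs ys y)
    then obtain e where e: "strict_mono_on {..<length xs} e"
      "\<forall>i<length xs. e i < length ys \<and> ys ! e i = xs ! i" by blast
    then show ?case by (intro exI[of _ "Suc \<circ> e"]) (auto simp: strict_mono_on_def)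
  next
    case (list_emb_Cons2 x y xs ys)
    then obtain e where e: "strict_mono_on {..<length xs} e"
      "\<forall>i<length xs. e i < length ys \<and> ys ! e i = xs ! i" by blast
    define e' where "e' i = (case i of 0 \<Rightarrow> 0 | Suc i \<Rightarrow> Suc (e i))" for i
    have "strict_mono_on {..<length (x # xs)} e'"
      using e(1) by (auto simp: strict_mono_on_def e'_def split: nat.splits)
    moreover have "\<forall>i<length (x # xs). e' i < length (y # ys) \<and> (y # ys) ! e' i = (x # xs) ! i"
      using e(2) list_emb_Cons2(1) by (auto simp: e'_def split: nat.splits)
    ultimately show ?case by blast
  qed
  then show thesis using that by blast
qed

section \<open>A well-quasi-order on words\<close>

text \<open>Composing a word with \<open>s\<close> repeats some of its letters. The fibres have size 1 modulo \<open>N\<close>, so that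
  sums over the positions of values killed by \<open>N\<close> do not change; this is what preserves symplectic
  forms. The fibres start in increasing order, so that the first position where two words
  differ goes to the first position where their composites differ; this is what preserves the
  lexicographic order.\<close>

definition regular_surj :: "nat \<Rightarrow> nat \<Rightarrow> nat \<Rightarrow> (nat \<Rightarrow> nat) \<Rightarrow> bool" where
  "regular_surj N n n' s \<longleftrightarrow>
     s \<in> {..<n'} \<rightarrow> {..<n} \<and>
     (\<forall>i<n. \<exists>m. card {j\<in>{..<n'}. s j = i} = Suc (N * m)) \<and>
     (\<forall>i<n. \<exists>j<n'. s j = i \<and> (\<forall>j'<j. s j' < i))"

lemma regular_surj_less:
  fixes u v :: "'a::linorder list"
  assumes s: "regular_surj N n n' s" and len: "length u = n" "length v = n" and less: "u < v"
  shows "map (\<lambda>j. u ! s j) [0..<n'] < map (\<lambda>j. v ! s j) [0..<n']"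
proof -
  obtain xs x y us vs where uv: "u = xs @ x # us" "v = xs @ y # vs" "x < y"
    using less len by (auto simp: list_less_def lenlex_conv lex_conv)
  let ?i = "length xs"
  have "?i < n" using uv len by simp
  then obtain j where j: "j < n'" "s j = ?i" "\<forall>j'<j. s j' < ?i"
    using s unfolding regular_surj_def by blast
  let ?f = "\<lambda>u. map (\<lambda>j. u ! s j) [0..<n']"
  have split: "?f w = take j (?f w) @ w ! ?i # drop (Suc j) (?f w)" for w :: "'a list"
    using id_take_nth_drop[of j "?f w"] j by simp
  have take: "take j (?f u) = take j (?f v)"
    using j by (intro nth_equalityI) (auto simp: uv nth_append)
  have "(?f u, ?f v) \<in> lex {(a, b). a < b}"
    unfolding lex_conv mem_Collect_eq prod.case
    by (intro conjI exI[of _ "take j (?f u)"] exI[of _ "u ! ?i"] exI[of _ "v ! ?i"]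
        exI[of _ "drop (Suc j) (?f u)"] exI[of _ "drop (Suc j) (?f v)"])
      (use split[of u] split[of v] take uv in \<open>simp_all\<close>)
  then show ?thesis by (simp add: list_less_def lenlex_conv)
qed

definition mark_new :: "'a list \<Rightarrow> ('a \<times> bool) list" where
  "mark_new w = map (\<lambda>i. (w ! i, w ! i \<notin> set (take i w))) [0..<length w]"

text \<open>Send a letter of \<open>w\<close> outside the copy of \<open>u\<close> to the first occurrence of the same letter in \<open>u\<close>.
  Because of the marks, this first occurrence is embedded at the first occurrence in \<open>w\<close>, so it
  comes before every letter that is sent to it. The number of letters that are added to a fibre
  is the difference of two letter counts, hence divisible by \<open>N\<close>.\<close>

lemma regular_surj_of_subseq:
  fixes u w :: "'a list"
  assumes sub: "subseq (mark_new u) (mark_new w)"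
    and set: "set u = set w"
    and cnt: "\<And>a. count_list u a mod N = count_list w a mod N"
  obtains s where "regular_surj N (length u) (length w) s"
    and "w = map (\<lambda>j. u ! s j) [0..<length w]"
proof -
  let ?n = "length u" and ?n' = "length w"
  have len[simp]: "length (mark_new v) = length v" for v :: "'a list" by (simp add: mark_new_def)
  obtain e where mono: "strict_mono_on {..<?n} e"
    and e: "\<And>i. i < ?n \<Longrightarrow> e i < ?n' \<and> mark_new w ! e i = mark_new u ! i"
    using subseq_index_embedding[OF sub] len by metis
  have e_less: "e i < ?n'" and e_nth: "w ! e i = u ! i"
    and e_new: "w ! e i \<in> set (take (e i) w) \<longleftrightarrow> u ! i \<in> set (take i u)" if "i < ?n" for i
    using e[OF that] that by (auto simp: mark_new_def)
  have new_iff: "v ! i \<in> set (take i v) \<longleftrightarrow> (\<exists>l<i. v ! l = v ! i)" if "i < length v" for v :: "'a list" and i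
    using that by (auto simp: in_set_conv_nth)
  have inj: "inj_on e {..<?n}" using mono by (rule strict_mono_on_imp_inj_on)
  define first where "first a = (LEAST i. i < ?n \<and> u ! i = a)" for a
  have first: "first a < ?n" "u ! first a = a" and first_le: "\<And>i. i < ?n \<Longrightarrow> u ! i = a \<Longrightarrow> first a \<le> i"
    if "a \<in> set u" for a
  proof -
    have "\<exists>i. i < ?n \<and> u ! i = a" using that by (auto simp: in_set_conv_nth)
    then have "first a < ?n \<and> u ! first a = a" unfolding first_def by (rule LeastI_ex)
    then show "first a < ?n" "u ! first a = a" by auto
    show "first a \<le> i" if "i < ?n" "u ! i = a" for i
      unfolding first_def using that by (intro Least_le) simp
  qed
  have e_first: "e (first a) \<le> j" if "j < ?n'" "w ! j = a" for a j
  proof (rule ccontr)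
    assume neg: "\<not> e (first a) \<le> j"
    have a: "a \<in> set u" using that set nth_mem by metis
    have "w ! e (first a) = a" using e_nth first[OF a] by simp
    then have "w ! e (first a) \<in> set (take (e (first a)) w)"
      unfolding new_iff[OF e_less[OF first(1)[OF a]]]
      using that neg by (intro exI[of _ j]) simp
    then have "u ! first a \<in> set (take (first a) u)" using e_new[OF first(1)[OF a]] by simp
    then obtain l where "l < first a" "u ! l = a"
      using new_iff[of "first a" u] first[OF a] by auto
    then show False using first_le[OF a, of l] first(1)[OF a] by linarith
  qed
  define s where "s j = (if j \<in> e ` {..<?n} then the_inv_into {..<?n} e j else first (w ! j))" for j
  have s_e: "s (e i) = i" if "i < ?n" for i
    using that inj by (simp add: s_def the_inv_into_f_f)
  have s_old: "s j = first (w ! j)" if "j \<notin> e ` {..<?n}" for j using that by (simp add: s_def)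
  have s_less: "s j < ?n" and s_nth: "u ! s j = w ! j" if "j < ?n'" for j
  proof -
    have "s j < ?n \<and> u ! s j = w ! j"
    proof (cases "j \<in> e ` {..<?n}")
      case True
      then show ?thesis using s_e e_nth by auto
    next
      case False
      have "w ! j \<in> set u" using that set nth_mem by metis
      then show ?thesis using False first s_old by simp
    qed
    then show "s j < ?n" "u ! s j = w ! j" by auto
  qed
  have cl: "count_list v a = card {i\<in>{..<length v}. v ! i = a}" for v :: "'a list" and a
    by (simp add: count_list_eq_length_filter length_filter_conv_card) (metis (mono_tags))
  have fibre: "\<exists>m. card {j\<in>{..<?n'}. s j = i} = Suc (N * m)" if i: "i < ?n" for i
  proof (cases "i = first (u ! i)")
    case False
    have "{j\<in>{..<?n'}. s j = i} = {e i}"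
    proof -
      have "j = e i" if "j < ?n'" "s j = i" for j
      proof (cases "j \<in> e ` {..<?n}")
        case True
        then show ?thesis using that(2) s_e by auto
      next
        case old: False
        have "w ! j = u ! i" using s_nth[OF that(1)] that(2) by simp
        then show ?thesis using s_old[OF old] that(2) False by simp
      qed
      moreover have "e i < ?n'" "s (e i) = i" using e_less[OF i] s_e[OF i] by simp_all
      ultimately show ?thesis by blast
    qed
    then have "card {j\<in>{..<?n'}. s j = i} = Suc (N * 0)" by simp
    then show ?thesis ..
  next
    case True
    let ?a = "u ! i"
    let ?D = "{j\<in>{..<?n'}. w ! j = ?a} - e ` {l\<in>{..<?n}. u ! l = ?a}"
    have "{j\<in>{..<?n'}. s j = i} = insert (e i) ?D"
    proof (intro equalityI subsetI)
      fix j assume "j \<in> {j\<in>{..<?n'}. s j = i}"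
      then have j: "j < ?n'" "s j = i" by simp_all
      then have "w ! j = ?a" using s_nth by metis
      moreover have "j = e i" if "j \<in> e ` {..<?n}" using that j(2) s_e by auto
      ultimately show "j \<in> insert (e i) ?D" using j(1) by blast
    next
      fix j assume "j \<in> insert (e i) ?D"
      then consider "j = e i" | "j \<in> ?D" by blast
      then show "j \<in> {j\<in>{..<?n'}. s j = i}"
      proof cases
        case 1
        then show ?thesis using e_less i s_e by simp
      next
        case 2
        then have "j \<notin> e ` {..<?n}" using e_nth by force
        then show ?thesis using 2 s_old True by simp
      qed
    qed
    moreover have "e i \<notin> ?D" using i by auto
    ultimately have card: "card {j\<in>{..<?n'}. s j = i} = Suc (card ?D)" by simp
    have sub: "e ` {l\<in>{..<?n}. u ! l = ?a} \<subseteq> {j\<in>{..<?n'}. w ! j = ?a}"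
      using e_less e_nth by auto
    have "card (e ` {l\<in>{..<?n}. u ! l = ?a}) = count_list u ?a"
      unfolding cl by (rule card_image) (rule inj_on_subset[OF inj], auto)
    then have D: "card ?D = count_list w ?a - count_list u ?a"
      and le: "count_list u ?a \<le> count_list w ?a"
      using sub card_Diff_subset[OF _ sub] card_mono[OF _ sub] cl[of w ?a] by simp_all
    have "N dvd card ?D"
      unfolding D using cnt[of ?a] le by (metis mod_eq_dvd_iff_nat)
    then show ?thesis using card by (auto elim: dvdE)
  qed
  have order: "\<exists>j<?n'. s j = i \<and> (\<forall>j'<j. s j' < i)" if i: "i < ?n" for i
  proof (intro exI[of _ "e i"] conjI allI impI)
    show "e i < ?n'" "s (e i) = i" using i e_less s_e by auto
    have lt: "l < i" if "e l < e i" "l < ?n" for l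
      using that mono i by (metis lessThan_iff linorder_neqE_nat order_less_asym strict_mono_onD)
    fix j assume j: "j < e i"
    then have j': "j < ?n'" using e_less[OF i] by simp
    show "s j < i"
    proof (cases "j \<in> e ` {..<?n}")
      case True
      then show ?thesis using lt j s_e by auto
    next
      case False
      have "e (first (w ! j)) < e i" using e_first[OF j' refl] j by simp
      then show ?thesis using lt s_less[OF j'] s_old[OF False] by simp
    qed
  qed
  have "regular_surj N ?n ?n' s"
    using s_less fibre order by (simp add: regular_surj_def)
  moreover have "w = map (\<lambda>j. u ! s j) [0..<?n']"
    by (rule nth_equalityI) (auto simp: s_nth)
  ultimately show thesis by (rule that)
qed

text \<open>Higman's lemma for the marked words, within an infinite set of words that agree in their sets of
  letters and in their letter counts modulo \<open>N\<close>.\<close>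

proposition regular_surj_good_pair:
  fixes w :: "nat \<Rightarrow> 'a list"
  assumes fin: "finite A" and N: "N > 0" and wA: "\<And>i. set (w i) \<subseteq> A"
  obtains i j s where "i < j" and "regular_surj N (length (w i)) (length (w j)) s"
    and "w j = map (\<lambda>l. w i ! s l) [0..<length (w j)]"
proof -
  define col where "col i = (set (w i), \<lambda>a\<in>A. count_list (w i) a mod N)" for i
  have "range col \<subseteq> Pow A \<times> (A \<rightarrow>\<^sub>E {..<N})"
    using wA N by (auto simp: col_def)
  moreover have "finite (Pow A \<times> (A \<rightarrow>\<^sub>E {..<N}))" using fin by (simp add: finite_PiE)
  ultimately have "finite (range col)" by (rule finite_subset)
  then obtain i0 where inf: "infinite {i. col i = col i0}"
    using pigeonhole_infinite[of UNIV col] by auto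
  define \<phi> where "\<phi> = enumerate {i. col i = col i0}"
  have \<phi>: "col (\<phi> n) = col i0" for n
    using enumerate_in_set[OF inf, of n] by (simp add: \<phi>_def)
  have \<phi>_less: "\<phi> m < \<phi> n" if "m < n" for m n
    using enumerate_mono[OF that inf] by (simp add: \<phi>_def)
  have "set (mark_new (w (\<phi> i))) \<subseteq> A \<times> UNIV" for i
    using wA nth_mem by (fastforce simp: mark_new_def)
  then obtain i j where ij: "i < j" "subseq (mark_new (w (\<phi> i))) (mark_new (w (\<phi> j)))"
    using higman[of "A \<times> (UNIV :: bool set)" "\<lambda>i. mark_new (w (\<phi> i))"] fin
    by (metis finite_SigmaI finite)
  have col: "col (\<phi> i) = col (\<phi> j)" using \<phi> by simp
  have "count_list (w (\<phi> i)) a mod N = count_list (w (\<phi> j)) a mod N" for a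
  proof (cases "a \<in> A")
    case True
    then show ?thesis using col by (auto simp: col_def dest: fun_cong[of _ _ a])
  next
    case False
    then show ?thesis using wA by (metis count_list_0_iff subsetD)
  qed
  then show thesis
    using regular_surj_of_subseq[OF ij(2), of N] col that[OF \<phi>_less[OF ij(1)]]
    by (auto simp: col_def)
qed

section \<open>Symplectic bases over a finite ring\<close>

context cring
begin

lemma finite_regular_imp_unit:
  assumes fin: "finite (carrier R)" and u: "u \<in> carrier R"
    and reg: "\<And>z. \<lbrakk>z \<in> carrier R; u \<otimes> z = \<zero>\<rbrakk> \<Longrightarrow> z = \<zero>"
  shows "u \<in> Units R"
proof -
  have "inj_on ((\<otimes>) u) (carrier R)"
  proof (rule inj_onI)
    fix y z assume yz: "y \<in> carrier R" "z \<in> carrier R" "u \<otimes> y = u \<otimes> z"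
    then have "u \<otimes> (y \<ominus> z) = \<zero>" using u by (simp add: minus_eq r_distr r_minus r_neg)
    then have "y \<ominus> z = \<zero>" using reg yz by simp
    then show "y = z" using yz by simp
  qed
  moreover have "(\<otimes>) u ` carrier R \<subseteq> carrier R" using u by auto
  ultimately have "(\<otimes>) u ` carrier R = carrier R" using fin endo_inj_surj by blast
  then obtain v where v: "v \<in> carrier R" "u \<otimes> v = \<one>" using one_closed by (metis imageE)
  then have "v \<otimes> u = \<one>" using u m_comm by simp
  then show ?thesis using u v by (auto simp: Units_def)
qed

lemma finite_idempotent_power:
  assumes fin: "finite (carrier R)" and a: "a \<in> carrier R"
  obtains n :: nat where "n > 0" "a [^] n \<otimes> a [^] n = a [^] n"
proof -
  have "range (\<lambda>i::nat. a [^] i) \<subseteq> carrier R" using a by auto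
  then have "\<not> inj (\<lambda>i::nat. a [^] i)"
    using fin finite_subset range_inj_infinite by blast
  then obtain i j :: nat where "a [^] i = a [^] j" "i \<noteq> j" by (auto simp: inj_def)
  then obtain i p :: nat where p: "a [^] (i + p) = a [^] i" "p > 0"
    by (metis less_imp_add_positive linorder_neqE_nat)
  have step: "a [^] (i + m + l * p) = a [^] (i + m)" for m l
  proof (induction l)
    case (Suc l)
    have "a [^] (i + m + Suc l * p) = a [^] (i + p) \<otimes> a [^] (m + l * p)"
      using a by (simp add: nat_pow_mult algebra_simps)
    also have "\<dots> = a [^] (i + m + l * p)" using p a by (simp add: nat_pow_mult algebra_simps)
    finally show ?case using Suc by simp
  qed simp
  define n where "n = Suc i * p"
  have "i \<le> n" using p(2) by (simp add: n_def) (metis One_nat_def Suc_leI le_add2 le_trans mult.right_neutral mult_le_mono2 trans_le_add1)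
  then have "a [^] (n + n) = a [^] n" using step[of "n - i" "Suc i"] by (simp add: n_def)
  then show thesis using that[of n] p(2) a by (simp add: nat_pow_mult n_def)
qed

text \<open>Let \<open>e\<close> be an idempotent power of \<open>a\<close>. On the factor \<open>eR\<close> the element \<open>a\<close> is invertible. On the
  complementary factor \<open>a\<close> is nilpotent, and therefore \<open>b\<close> is invertible there, because
  \<open>ax + b = 1\<close>. Hence \<open>t = 1 - e\<close> works.\<close>

lemma finite_stable_range:
  assumes fin: "finite (carrier R)"
    and abx: "a \<in> carrier R" "b \<in> carrier R" "x \<in> carrier R" and one: "a \<otimes> x \<oplus> b = \<one>"
  obtains t where "t \<in> carrier R" "a \<oplus> t \<otimes> b \<in> Units R"
proof -
  obtain n :: nat where n: "n > 0" "a [^] n \<otimes> a [^] n = a [^] n"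
    using finite_idempotent_power[OF fin abx(1)] by blast
  define e where "e = a [^] n"
  define c where "c = a [^] (n - 1)"
  have ec: "e \<in> carrier R" "c \<in> carrier R" using abx by (simp_all add: e_def c_def)
  have ee: "e \<otimes> e = e" using n by (simp add: e_def)
  have ac: "c \<otimes> a = e" using n(1) abx(1) by (cases n) (simp_all add: c_def e_def)
  define t where "t = \<one> \<ominus> e"
  have t: "t \<in> carrier R" using ec by (simp add: t_def)
  have "a \<oplus> t \<otimes> b \<in> Units R"
  proof (rule finite_regular_imp_unit[OF fin])
    fix z assume z: "z \<in> carrier R" and uz: "(a \<oplus> t \<otimes> b) \<otimes> z = \<zero>"
    have et: "e \<otimes> t = \<zero>" using ec ee by (simp add: t_def minus_eq r_distr r_minus r_neg)
    have "e \<otimes> (a \<otimes> z) = e \<otimes> ((a \<oplus> t \<otimes> b) \<otimes> z) \<ominus> (e \<otimes> t) \<otimes> b \<otimes> z"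
      using abx z ec t by algebra
    also have "\<dots> = \<zero>" using uz et abx z ec by (simp add: minus_eq)
    finally have "e \<otimes> (a \<otimes> z) = \<zero>" .
    then have "c \<otimes> (e \<otimes> (a \<otimes> z)) = \<zero>" using ec by simp
    moreover have "c \<otimes> (e \<otimes> (a \<otimes> z)) = e \<otimes> (c \<otimes> a) \<otimes> z" using ec abx z by algebra
    ultimately have ez: "e \<otimes> z = \<zero>" by (simp add: ac ee)
    have "a \<otimes> z \<oplus> b \<otimes> z = (a \<oplus> t \<otimes> b) \<otimes> z \<oplus> b \<otimes> (e \<otimes> z)"
      unfolding t_def using abx z ec by algebra
    then have az: "a \<otimes> z \<oplus> b \<otimes> z = \<zero>" using uz ez abx by simp
    define v where "v = a \<otimes> (x \<ominus> \<one>)"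
    have v: "v \<in> carrier R" using abx by (simp add: v_def)
    have "v \<otimes> z = (a \<otimes> x \<oplus> b) \<otimes> z \<ominus> (a \<otimes> z \<oplus> b \<otimes> z)"
      unfolding v_def using abx z by algebra
    then have vz: "v \<otimes> z = z" using one az z by (simp add: minus_eq)
    have "v [^] i \<otimes> z = z" for i :: nat
    proof (induction i)
      case (Suc i)
      have "v [^] Suc i \<otimes> z = v [^] i \<otimes> (v \<otimes> z)" using v z by (simp add: m_assoc)
      then show ?case using Suc vz by simp
    qed (use z in simp)
    then have "z = v [^] n \<otimes> z" by simp
    also have "\<dots> = (x \<ominus> \<one>) [^] n \<otimes> (e \<otimes> z)"
      unfolding v_def e_def using abx z by (simp add: nat_pow_distrib m_ac)
    also have "\<dots> = \<zero>" using ez abx by simp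
    finally show "z = \<zero>" .
  qed (use abx t in simp)
  then show thesis using that t by blast
qed

end

lemma card_surj_image_eq_imp_inj:
  "\<lbrakk>finite A; card A \<le> card (f ` A)\<rbrakk> \<Longrightarrow> inj_on f A"
  using card_image_le[of A f] by (intro eq_card_imp_inj_on) auto

context module
begin

lemma span_insert_iff:
  assumes b: "b \<in> carrier M" and G: "G \<subseteq> carrier M"
  shows "x \<in> module_span R M (insert b G) \<longleftrightarrow>
    (\<exists>a\<in>carrier R. \<exists>z\<in>module_span R M G. x = a \<odot>\<^bsub>M\<^esub> b \<oplus>\<^bsub>M\<^esub> z)"
proof
  assume "x \<in> module_span R M (insert b G)"
  then show "\<exists>a\<in>carrier R. \<exists>z\<in>module_span R M G. x = a \<odot>\<^bsub>M\<^esub> b \<oplus>\<^bsub>M\<^esub> z"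
  proof induction
    case span_zero
    have "\<zero>\<^bsub>M\<^esub> = \<zero> \<odot>\<^bsub>M\<^esub> b \<oplus>\<^bsub>M\<^esub> \<zero>\<^bsub>M\<^esub>" using b by simp
    then show ?case using module_span.span_zero R.zero_closed by blast
  next
    case (span_step c g y)
    then obtain a z where az: "a \<in> carrier R" "z \<in> module_span R M G" "y = a \<odot>\<^bsub>M\<^esub> b \<oplus>\<^bsub>M\<^esub> z" by blast
    have zc: "z \<in> carrier M" using az module_span_closed[OF G] by blast
    show ?case
    proof (cases "g = b")
      case True
      have "c \<odot>\<^bsub>M\<^esub> g \<oplus>\<^bsub>M\<^esub> y = (c \<oplus> a) \<odot>\<^bsub>M\<^esub> b \<oplus>\<^bsub>M\<^esub> z"
        using True az zc b span_step.hyps by (simp add: smult_l_distr M.a_assoc)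
      then show ?thesis using az span_step.hyps R.a_closed by blast
    next
      case False
      then have g: "g \<in> G" "g \<in> carrier M" using span_step.hyps G by auto
      have "c \<odot>\<^bsub>M\<^esub> g \<oplus>\<^bsub>M\<^esub> y = a \<odot>\<^bsub>M\<^esub> b \<oplus>\<^bsub>M\<^esub> (c \<odot>\<^bsub>M\<^esub> g \<oplus>\<^bsub>M\<^esub> z)"
        using g az zc b span_step.hyps by (simp add: M.a_lcomm)
      moreover have "c \<odot>\<^bsub>M\<^esub> g \<oplus>\<^bsub>M\<^esub> z \<in> module_span R M G"
        using az g span_step.hyps by (intro module_span.span_step)
      ultimately show ?thesis using az(1) by blast
    qed
  qed
next
  assume "\<exists>a\<in>carrier R. \<exists>z\<in>module_span R M G. x = a \<odot>\<^bsub>M\<^esub> b \<oplus>\<^bsub>M\<^esub> z"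
  then show "x \<in> module_span R M (insert b G)"
    using module_span_mono[of G "insert b G" R M] by (blast intro: span_step)
qed

lemma span_insert_cong:
  assumes "b \<in> carrier M" "G \<subseteq> carrier M" "H \<subseteq> carrier M"
    and "module_span R M G = module_span R M H"
  shows "module_span R M (insert b G) = module_span R M (insert b H)"
  using assms by (auto simp: span_insert_iff)

lemma module_span_idem:
  assumes "G \<subseteq> carrier M" "H \<subseteq> module_span R M G"
  shows "module_span R M H \<subseteq> module_span R M G"
  by (rule module_span_minimal[OF module_span_submodule[OF assms(1)] assms(2)])

lemma finite_span_insert:
  assumes "finite (carrier R)" "b \<in> carrier M" "G \<subseteq> carrier M" "finite (module_span R M G)"
  shows "finite (module_span R M (insert b G))"
    and "card (module_span R M (insert b G)) \<le> card (carrier R) * card (module_span R M G)"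
proof -
  have eq: "module_span R M (insert b G) = (\<lambda>(a, z). a \<odot>\<^bsub>M\<^esub> b \<oplus>\<^bsub>M\<^esub> z) ` (carrier R \<times> module_span R M G)"
    using span_insert_iff[OF assms(2,3)] by auto
  show "finite (module_span R M (insert b G))" unfolding eq using assms by simp
  show "card (module_span R M (insert b G)) \<le> card (carrier R) * card (module_span R M G)"
    unfolding eq using assms card_image_le[of "carrier R \<times> module_span R M G"] 
    by (simp add: card_cartesian_product)
qed

lemma module_span_empty: "module_span R M {} = {\<zero>\<^bsub>M\<^esub>}"
  by (auto elim: module_span.cases intro: span_zero)

lemma finite_span:
  assumes "finite (carrier R)" "set bs \<subseteq> carrier M"
  shows "finite (module_span R M (set bs))
    \<and> card (module_span R M (set bs)) \<le> card (carrier R) ^ length bs"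
  using assms(2)
proof (induction bs)
  case Nil
  then show ?case by (simp add: module_span_empty)
next
  case (Cons b bs)
  then have IH: "finite (module_span R M (set bs))"
    "card (module_span R M (set bs)) \<le> card (carrier R) ^ length bs" and b: "b \<in> carrier M" "set bs \<subseteq> carrier M"
    by auto
  show ?case
    using finite_span_insert[OF assms(1) b IH(1)]
      order_trans[OF _ mult_le_mono2[OF IH(2), of "card (carrier R)"]] by simp
qed

definition functional :: "'c set \<Rightarrow> ('c \<Rightarrow> 'a) \<Rightarrow> bool" where
  "functional U l \<longleftrightarrow> (\<forall>v\<in>U. l v \<in> carrier R) \<and>
     (\<forall>u\<in>U. \<forall>v\<in>U. l (u \<oplus>\<^bsub>M\<^esub> v) = l u \<oplus> l v) \<and>
     (\<forall>a\<in>carrier R. \<forall>v\<in>U. l (a \<odot>\<^bsub>M\<^esub> v) = a \<otimes> l v)"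

text \<open>A spanning list of length \<open>n\<close> in a set of size \<open>|R|\<^sup>n\<close> is a basis, since a surjection between
  finite sets of equal size is injective. Counting replaces linear
  independence here and in the construction of a symplectic basis, where only spanning has to be
  checked when the list changes.\<close>

lemma coordinate_functional:
  assumes fin: "finite (carrier R)" and bs: "set (b # cs) \<subseteq> carrier M"
    and card: "card (module_span R M (set (b # cs))) = card (carrier R) ^ length (b # cs)"
  obtains l where "functional (module_span R M (set (b # cs))) l" and "l b = \<one>"
proof -
  let ?U = "module_span R M (set (b # cs))" and ?W = "module_span R M (set cs)"
  have b: "b \<in> carrier M" and cs: "set cs \<subseteq> carrier M" using bs by auto
  note W = finite_span[OF fin cs]
  define f where "f = (\<lambda>(a, z). a \<odot>\<^bsub>M\<^esub> b \<oplus>\<^bsub>M\<^esub> z)"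
  have img: "f ` (carrier R \<times> ?W) = ?U"
    using span_insert_iff[OF b cs] by (auto simp: f_def)
  have "card (carrier R \<times> ?W) \<le> card ?U"
    unfolding card using W by (simp add: card_cartesian_product)
  then have inj: "inj_on f (carrier R \<times> ?W)"
    using fin W img by (intro card_surj_image_eq_imp_inj) auto
  define l where "l v = fst (the_inv_into (carrier R \<times> ?W) f v)" for v
  have l: "l (a \<odot>\<^bsub>M\<^esub> b \<oplus>\<^bsub>M\<^esub> z) = a" if "a \<in> carrier R" "z \<in> ?W" for a z
    using the_inv_into_f_f[OF inj, of "(a, z)"] that by (simp add: l_def f_def)
  have dec: "\<exists>a\<in>carrier R. \<exists>z\<in>?W. v = a \<odot>\<^bsub>M\<^esub> b \<oplus>\<^bsub>M\<^esub> z" if "v \<in> ?U" for v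
    using that span_insert_iff[OF b cs] by simp
  note closed = module_span_closed[OF cs]
  have "functional ?U l"
    unfolding functional_def
  proof (intro conjI ballI)
    fix v assume "v \<in> ?U"
    then show "l v \<in> carrier R" using dec l by force
  next
    fix u v assume "u \<in> ?U" "v \<in> ?U"
    then obtain a y c z where u: "a \<in> carrier R" "y \<in> ?W" "u = a \<odot>\<^bsub>M\<^esub> b \<oplus>\<^bsub>M\<^esub> y"
      and v: "c \<in> carrier R" "z \<in> ?W" "v = c \<odot>\<^bsub>M\<^esub> b \<oplus>\<^bsub>M\<^esub> z" using dec by meson
    have "u \<oplus>\<^bsub>M\<^esub> v = (a \<oplus> c) \<odot>\<^bsub>M\<^esub> b \<oplus>\<^bsub>M\<^esub> (y \<oplus>\<^bsub>M\<^esub> z)"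
      using u v b closed[of y] closed[of z] by (simp add: smult_l_distr M.a_ac)
    then show "l (u \<oplus>\<^bsub>M\<^esub> v) = l u \<oplus> l v"
      using u v l module_span_add[OF cs] by simp
  next
    fix a v assume a: "a \<in> carrier R" and "v \<in> ?U"
    then obtain c z where v: "c \<in> carrier R" "z \<in> ?W" "v = c \<odot>\<^bsub>M\<^esub> b \<oplus>\<^bsub>M\<^esub> z" using dec by meson
    have "a \<odot>\<^bsub>M\<^esub> v = (a \<otimes> c) \<odot>\<^bsub>M\<^esub> b \<oplus>\<^bsub>M\<^esub> a \<odot>\<^bsub>M\<^esub> z"
      using a v b closed[of z] by (simp add: smult_r_distr smult_assoc1)
    then show "l (a \<odot>\<^bsub>M\<^esub> v) = a \<otimes> l v"
      using a v l module_span_smult[OF cs] by simp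
  qed
  moreover have "l b = \<one>"
    using l[of \<one> "\<zero>\<^bsub>M\<^esub>"] b by (simp add: span_zero)
  ultimately show thesis by (rule that)
qed

end

lemma (in abelian_monoid) finsum_lessThan_Suc_shift:
  assumes f: "f \<in> {..<Suc n} \<rightarrow> carrier G"
  shows "finsum G f {..<Suc n} = f 0 \<oplus> finsum G (\<lambda>i. f (Suc i)) {..<n}"
proof -
  have "finsum G f (Suc ` {..<n}) = finsum G (\<lambda>i. f (Suc i)) {..<n}"
    using f by (intro add.finprod_reindex) (auto simp: Pi_iff)
  then show ?thesis
    unfolding lessThan_Suc_eq_insert_0 using f by (subst finsum_insert) (auto simp: Pi_iff)
qed

locale alternating_form = module R M
  for R :: "('r, 'x) ring_scheme" (structure) and M :: "('r, 'v, 'y) module_scheme" (structure) +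
  fixes \<omega> :: "'v \<Rightarrow> 'v \<Rightarrow> 'r"
  assumes \<omega>_closed [simp, intro]: "\<lbrakk>x \<in> carrier M; y \<in> carrier M\<rbrakk> \<Longrightarrow> \<omega> x y \<in> carrier R"
    and \<omega>_add_left: "\<lbrakk>x \<in> carrier M; y \<in> carrier M; z \<in> carrier M\<rbrakk>
      \<Longrightarrow> \<omega> (x \<oplus>\<^bsub>M\<^esub> y) z = \<omega> x z \<oplus> \<omega> y z"
    and \<omega>_add_right: "\<lbrakk>x \<in> carrier M; y \<in> carrier M; z \<in> carrier M\<rbrakk>
      \<Longrightarrow> \<omega> z (x \<oplus>\<^bsub>M\<^esub> y) = \<omega> z x \<oplus> \<omega> z y"
    and \<omega>_smult_left: "\<lbrakk>a \<in> carrier R; x \<in> carrier M; z \<in> carrier M\<rbrakk>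
      \<Longrightarrow> \<omega> (a \<odot>\<^bsub>M\<^esub> x) z = a \<otimes> \<omega> x z"
    and \<omega>_smult_right: "\<lbrakk>a \<in> carrier R; x \<in> carrier M; z \<in> carrier M\<rbrakk>
      \<Longrightarrow> \<omega> z (a \<odot>\<^bsub>M\<^esub> x) = a \<otimes> \<omega> z x"
    and \<omega>_alt [simp]: "x \<in> carrier M \<Longrightarrow> \<omega> x x = \<zero>"
begin

lemmas \<omega>_linear = \<omega>_add_left \<omega>_add_right \<omega>_smult_left \<omega>_smult_right

lemma \<omega>_skew:
  assumes "x \<in> carrier M" "y \<in> carrier M"
  shows "\<omega> y x = \<ominus> \<omega> x y"
proof -
  have "\<omega> (x \<oplus>\<^bsub>M\<^esub> y) (x \<oplus>\<^bsub>M\<^esub> y) = \<omega> y x \<oplus> \<omega> x y"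
    using assms by (subst \<omega>_add_left) (simp_all add: \<omega>_add_right R.a_comm)
  then have "\<omega> y x \<oplus> \<omega> x y = \<zero>" using assms by simp
  then show ?thesis using assms by (simp add: R.sum_zero_eq_neg)
qed

lemma \<omega>_zero_right [simp]: "x \<in> carrier M \<Longrightarrow> \<omega> x \<zero>\<^bsub>M\<^esub> = \<zero>"
  using \<omega>_smult_right[of \<zero> "\<zero>\<^bsub>M\<^esub>" x] by simp

lemma \<omega>_span_zero:
  assumes x: "x \<in> carrier M" and G: "G \<subseteq> carrier M" "\<And>g. g \<in> G \<Longrightarrow> \<omega> x g = \<zero>"
    and z: "z \<in> module_span R M G"
  shows "\<omega> x z = \<zero>" "\<omega> z x = \<zero>"
proof -
  show 1: "\<omega> x z = \<zero>"
    using z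
  proof induction
    case (span_step a g z)
    then show ?case using x G module_span_closed[OF G(1)] by (simp add: \<omega>_linear subset_iff)
  qed (use x in simp)
  show "\<omega> z x = \<zero>" using \<omega>_skew[of x z] 1 x module_span_closed[OF G(1) z] by simp
qed

text \<open>Nondegeneracy of the restriction of the form to \<open>U\<close>. In the form of surjectivity onto the
  dual it passes to orthogonal complements.\<close>

definition self_dual :: "'v set \<Rightarrow> bool" where
  "self_dual U \<longleftrightarrow> (\<forall>l. functional U l \<longrightarrow> (\<exists>y\<in>U. \<forall>v\<in>U. \<omega> y v = l v))"

definition gens :: "('v \<times> 'v) list \<Rightarrow> 'v set" where
  "gens ps = fst ` set ps \<union> snd ` set ps"

primrec hyperbolic :: "('v \<times> 'v) list \<Rightarrow> bool" where
  "hyperbolic [] \<longleftrightarrow> True"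
| "hyperbolic (p # ps) \<longleftrightarrow> fst p \<in> carrier M \<and> snd p \<in> carrier M \<and> \<omega> (fst p) (snd p) = \<one> \<and>
     (\<forall>g\<in>gens ps. \<omega> (fst p) g = \<zero> \<and> \<omega> (snd p) g = \<zero>) \<and> hyperbolic ps"

lemma gens_Cons: "gens (p # ps) = insert (fst p) (insert (snd p) (gens ps))"
  by (auto simp: gens_def)

lemma hyperbolic_gens_carrier: "hyperbolic ps \<Longrightarrow> gens ps \<subseteq> carrier M"
  by (induction ps) (auto simp: gens_def)

text \<open>If \<open>\<omega> b c = 1\<close>, this is the orthogonal projection with kernel the plane spanned by \<open>b\<close> and \<open>c\<close>.\<close>

definition perp_proj :: "'v \<Rightarrow> 'v \<Rightarrow> 'v \<Rightarrow> 'v" where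
  "perp_proj b c v = v \<oplus>\<^bsub>M\<^esub> ((\<ominus> \<omega> v c) \<odot>\<^bsub>M\<^esub> b \<oplus>\<^bsub>M\<^esub> \<omega> v b \<odot>\<^bsub>M\<^esub> c)"

lemma perp_proj_linear:
  assumes b: "b \<in> carrier M" and c: "c \<in> carrier M"
  shows "linear_map R M M (perp_proj b c)"
  unfolding linear_map_def
proof (intro conjI ballI)
  fix u v assume uv: "u \<in> carrier M" "v \<in> carrier M"
  show "perp_proj b c (u \<oplus>\<^bsub>M\<^esub> v) = perp_proj b c u \<oplus>\<^bsub>M\<^esub> perp_proj b c v"
  proof -
    have "(\<ominus> (\<omega> u c \<oplus> \<omega> v c)) \<odot>\<^bsub>M\<^esub> b = (\<ominus> \<omega> u c) \<odot>\<^bsub>M\<^esub> b \<oplus>\<^bsub>M\<^esub> (\<ominus> \<omega> v c) \<odot>\<^bsub>M\<^esub> b"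
      using uv b c by (simp add: R.minus_add smult_l_distr)
    moreover have "(\<omega> u b \<oplus> \<omega> v b) \<odot>\<^bsub>M\<^esub> c = \<omega> u b \<odot>\<^bsub>M\<^esub> c \<oplus>\<^bsub>M\<^esub> \<omega> v b \<odot>\<^bsub>M\<^esub> c"
      using uv b c by (simp add: smult_l_distr)
    ultimately show ?thesis
      using uv b c by (simp add: perp_proj_def \<omega>_linear M.add.m_ac)
  qed
next
  fix a v assume av: "a \<in> carrier R" "v \<in> carrier M"
  show "perp_proj b c (a \<odot>\<^bsub>M\<^esub> v) = a \<odot>\<^bsub>M\<^esub> perp_proj b c v"
    using av b c by (simp add: perp_proj_def \<omega>_linear smult_r_distr smult_assoc1[symmetric] r_minus)
qed (use b c in \<open>auto simp: perp_proj_def\<close>)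

lemma perp_proj_orthogonal:
  assumes "b \<in> carrier M" "c \<in> carrier M" "\<omega> b c = \<one>" "v \<in> carrier M"
  shows "\<omega> b (perp_proj b c v) = \<zero>" "\<omega> c (perp_proj b c v) = \<zero>"
  using assms \<omega>_skew[of b c] \<omega>_skew[of v b] \<omega>_skew[of v c]
  by (simp_all add: perp_proj_def \<omega>_linear R.l_neg R.r_neg r_minus)

lemma perp_proj_fixes:
  assumes "b \<in> carrier M" "c \<in> carrier M" "v \<in> carrier M" "\<omega> b v = \<zero>" "\<omega> c v = \<zero>"
  shows "perp_proj b c v = v"
  using assms \<omega>_skew[of b v] \<omega>_skew[of c v] by (simp add: perp_proj_def)

lemma perp_proj_kills:
  assumes "b \<in> carrier M" "c \<in> carrier M" "\<omega> b c = \<one>"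
  shows "perp_proj b c b = \<zero>\<^bsub>M\<^esub>" "perp_proj b c c = \<zero>\<^bsub>M\<^esub>"
  using assms \<omega>_skew[of b c] by (simp_all add: perp_proj_def smult_l_minus M.r_neg)

lemma perp_proj_in_span:
  assumes b: "b \<in> carrier M" and c: "c \<in> carrier M" and bc: "\<omega> b c = \<one>"
    and D: "D \<subseteq> carrier M" "\<And>d. d \<in> D \<Longrightarrow> \<omega> b d = \<zero> \<and> \<omega> c d = \<zero>"
    and v: "v \<in> module_span R M (insert b (insert c D))"
  shows "perp_proj b c v \<in> module_span R M D"
proof -
  have "perp_proj b c v \<in> module_span R M (module_span R M D)"
  proof (rule linear_map_module_span[OF module_axioms module_axioms perp_proj_linear[OF b c] _ v])
    show "insert b (insert c D) \<subseteq> carrier M" using b c D by simp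
    show "perp_proj b c g \<in> module_span R M D" if g: "g \<in> insert b (insert c D)" for g
    proof (cases "g \<in> D")
      case True
      then have "perp_proj b c g = g" using D by (intro perp_proj_fixes b c) auto
      then show ?thesis using module_span_incl[OF D(1) True] by simp
    next
      case False
      then show ?thesis using g perp_proj_kills[OF b c bc] by (auto simp: span_zero)
    qed
  qed
  then show ?thesis using module_span_idem[OF D(1) order_refl] by blast
qed

text \<open>A functional on the orthogonal complement of a hyperbolic plane extends to the whole by composition
  with the projection; the projection of the vector that represents the extension represents the
  given functional.\<close>

lemma self_dual_complement:
  assumes b: "b \<in> carrier M" and c: "c \<in> carrier M" and bc: "\<omega> b c = \<one>"
    and D: "D \<subseteq> carrier M" "\<And>d. d \<in> D \<Longrightarrow> \<omega> b d = \<zero> \<and> \<omega> c d = \<zero>"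
    and dual: "self_dual (module_span R M (insert b (insert c D)))"
  shows "self_dual (module_span R M D)"
  unfolding self_dual_def
proof (intro allI impI)
  fix l assume l: "functional (module_span R M D) l"
  let ?W = "module_span R M D" and ?U = "module_span R M (insert b (insert c D))"
  have gU: "insert b (insert c D) \<subseteq> carrier M" using b c D by simp
  have P: "perp_proj b c v \<in> ?W" if "v \<in> ?U" for v by (rule perp_proj_in_span[OF b c bc D that])
  have U: "v \<in> carrier M" if "v \<in> ?U" for v by (rule module_span_closed[OF gU that])
  have WU: "?W \<subseteq> ?U" by (rule module_span_mono) auto
  have orth: "\<omega> b v = \<zero>" "\<omega> c v = \<zero>" if "v \<in> ?W" for v
    using \<omega>_span_zero(1)[OF b D(1) _ that] \<omega>_span_zero(1)[OF c D(1) _ that] D(2) by blast+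
  have "functional ?U (\<lambda>v. l (perp_proj b c v))"
    using l P perp_proj_linear[OF b c] U unfolding functional_def linear_map_def by simp
  then obtain y where y: "y \<in> ?U" "\<And>v. v \<in> ?U \<Longrightarrow> \<omega> y v = l (perp_proj b c v)"
    using dual unfolding self_dual_def by blast
  have "\<omega> (perp_proj b c y) v = l v" if v: "v \<in> ?W" for v
  proof -
    have vM: "v \<in> carrier M" and yM: "y \<in> carrier M" using v WU U y by auto
    have "\<omega> (perp_proj b c y) v = \<omega> y v"
      using b c vM yM orth[OF v] by (simp add: perp_proj_def \<omega>_linear)
    also have "\<dots> = l v"
      using y(2) v WU perp_proj_fixes[OF b c vM orth[OF v]] by auto
    finally show ?thesis .
  qed
  then show "\<exists>y\<in>?W. \<forall>v\<in>?W. \<omega> y v = l v" using P[OF y(1)] by blast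
qed

lemma span_insert2:
  assumes "b \<in> carrier M" "c \<in> carrier M" "D \<subseteq> carrier M"
    and "v \<in> module_span R M (insert b (insert c D))"
  obtains s t z where "s \<in> carrier R" "t \<in> carrier R" "z \<in> module_span R M D"
    and "v = s \<odot>\<^bsub>M\<^esub> b \<oplus>\<^bsub>M\<^esub> (t \<odot>\<^bsub>M\<^esub> c \<oplus>\<^bsub>M\<^esub> z)"
  using assms span_insert_iff[of b "insert c D" v] span_insert_iff[of c D] by auto

text \<open>The values of \<open>\<omega> b\<close> on \<open>c # ds\<close> generate the unit ideal, so by the stable range property
  some vector in the span of \<open>ds\<close> can be added to \<open>c\<close> to make the value of \<open>\<omega> b\<close> a unit. As \<open>c\<close> is
  changed by the other vectors and not replaced by a combination of all of them, the projections of
  \<open>ds\<close> span the complement of \<open>b\<close> and the rescaled \<open>c'\<close>. So the complement is generated by two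
  elements fewer, which over a general ring it need not be.\<close>

lemma split_hyperbolic_pair:
  assumes fin: "finite (carrier R)" and bs: "set (b # c # ds) \<subseteq> carrier M"
    and one: "\<omega> b z = \<one>" and z: "z \<in> module_span R M (set (c # ds))"
  obtains c' where "c' \<in> carrier M" "\<omega> b c' = \<one>"
    and "module_span R M (insert b (insert c' (perp_proj b c' ` set ds))) = module_span R M (set (b # c # ds))"
proof -
  let ?U = "module_span R M (set (b # c # ds))"
  have b: "b \<in> carrier M" and c: "c \<in> carrier M" and ds: "set ds \<subseteq> carrier M" using bs by auto
  obtain x d where x: "x \<in> carrier R" and d: "d \<in> module_span R M (set ds)"
    and zxd: "z = x \<odot>\<^bsub>M\<^esub> c \<oplus>\<^bsub>M\<^esub> d"
    using z span_insert_iff[OF c ds] by auto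
  have dM: "d \<in> carrier M" by (rule module_span_closed[OF ds d])
  have "\<omega> b c \<otimes> x \<oplus> \<omega> b d = \<one>"
    using one b c x dM by (simp add: zxd \<omega>_linear m_comm)
  then obtain t where t: "t \<in> carrier R" and unit: "\<omega> b c \<oplus> t \<otimes> \<omega> b d \<in> Units R"
    using finite_stable_range[OF fin, of "\<omega> b c" "\<omega> b d" x] b c x dM by auto
  define u where "u = \<omega> b c \<oplus> t \<otimes> \<omega> b d"
  have u: "u \<in> Units R" "u \<in> carrier R" "inv u \<in> carrier R" using unit by (auto simp: u_def)
  define c' where "c' = inv u \<odot>\<^bsub>M\<^esub> (c \<oplus>\<^bsub>M\<^esub> t \<odot>\<^bsub>M\<^esub> d)"
  have c': "c' \<in> carrier M" using u c t dM by (simp add: c'_def)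
  have bc': "\<omega> b c' = \<one>"
    using u b c t dM by (simp add: c'_def \<omega>_linear u_def[symmetric])
  have uc': "c = u \<odot>\<^bsub>M\<^esub> c' \<oplus>\<^bsub>M\<^esub> (\<ominus> t) \<odot>\<^bsub>M\<^esub> d"
    using u c t dM
    by (simp add: c'_def smult_assoc1[symmetric] M.a_assoc smult_l_minus M.r_neg)
  let ?G = "insert b (insert c' (perp_proj b c' ` set ds))"
  have PM: "perp_proj b c' v \<in> carrier M" if "v \<in> carrier M" for v
    using perp_proj_linear[OF b c'] that by (auto simp: linear_map_def)
  then have G: "?G \<subseteq> carrier M" using b c' ds by auto
  note subU = submoduleE[OF module_span_submodule[OF bs]]
  note subG = submoduleE[OF module_span_submodule[OF G]]
  have mem: "g \<in> ?U" if "g \<in> set (b # c # ds)" for g using module_span_incl[OF bs that] .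
  have dU: "d \<in> ?U" using d module_span_mono[of "set ds" "set (b # c # ds)" R M] by auto
  have c'U: "c' \<in> ?U" unfolding c'_def
    using mem dU u t by (intro subU(4,5)) auto
  have "perp_proj b c' v \<in> ?U" if "v \<in> set ds" for v
    unfolding perp_proj_def using mem c'U that b c' ds by (intro subU(4,5)) auto
  then have 1: "module_span R M ?G \<subseteq> ?U"
    using mem c'U by (intro module_span_idem[OF bs]) auto
  have memG: "g \<in> module_span R M ?G" if "g \<in> ?G" for g using module_span_incl[OF G that] .
  have dsG: "set ds \<subseteq> module_span R M ?G"
  proof
    fix v assume v: "v \<in> set ds"
    let ?e = "(\<ominus> \<omega> v c') \<odot>\<^bsub>M\<^esub> b \<oplus>\<^bsub>M\<^esub> \<omega> v b \<odot>\<^bsub>M\<^esub> c'"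
    have vM: "v \<in> carrier M" using v ds by auto
    then have "v = perp_proj b c' v \<oplus>\<^bsub>M\<^esub> \<ominus>\<^bsub>M\<^esub> ?e"
      using b c' by (simp add: perp_proj_def M.a_assoc M.r_neg)
    moreover have "?e \<in> module_span R M ?G"
      using memG vM b c' by (intro subG(4,5)) auto
    ultimately show "v \<in> module_span R M ?G"
      using memG v subG(3,5) by (metis image_eqI insertCI)
  qed
  have "d \<in> module_span R M ?G" using d module_span_idem[OF G dsG] by auto
  then have "c \<in> module_span R M ?G"
    using memG u t by (subst uc') (intro subG(4,5), auto)
  then have 2: "?U \<subseteq> module_span R M ?G"
    using memG dsG by (intro module_span_idem[OF G]) auto
  show thesis using that[OF c' bc'] 1 2 by blast
qed

text \<open>Symplectic Gram-Schmidt. By self-duality the coordinate functional of the first vector \<open>b\<close> is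
  represented by some \<open>y\<close>, which gives a vector pairing to 1 with \<open>b\<close>. Splitting off a
  hyperbolic plane reduces to a list that is shorter by two. If \<open>b\<close> is the only vector left, then
  \<open>\<omega> b b = 0\<close> forces the ring to be zero.\<close>

proposition hyperbolic_basis:
  assumes fin: "finite (carrier R)" and "set bs \<subseteq> carrier M"
    and "card (module_span R M (set bs)) = card (carrier R) ^ length bs"
    and "self_dual (module_span R M (set bs))"
  shows "\<exists>ps. hyperbolic ps \<and> module_span R M (gens ps) = module_span R M (set bs)"
  using assms(2-)
proof (induction "length bs" arbitrary: bs rule: less_induct)
  case less
  note bs = less.prems(1) and card = less.prems(2) and dual = less.prems(3)
  show ?case
  proof (cases bs)
    case Nil
    then show ?thesis by (intro exI[of _ "[]"]) (simp add: gens_def)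
  next
    case (Cons b cs)
    let ?U = "module_span R M (set bs)"
    have b: "b \<in> carrier M" and cs: "set cs \<subseteq> carrier M" using bs Cons by auto
    obtain l where l: "functional ?U l" "l b = \<one>"
      using coordinate_functional[OF fin] bs card unfolding Cons by metis
    then obtain y where y: "y \<in> ?U" "\<And>v. v \<in> ?U \<Longrightarrow> \<omega> y v = l v"
      using dual unfolding self_dual_def by blast
    have yM: "y \<in> carrier M" using module_span_closed[OF bs y(1)] .
    have "b \<in> ?U" using module_span_incl[OF bs] Cons by simp
    then have yb: "\<omega> y b = \<one>" using y l by simp
    obtain a z where a: "a \<in> carrier R" and z: "z \<in> module_span R M (set cs)"
      and y_eq: "y = a \<odot>\<^bsub>M\<^esub> b \<oplus>\<^bsub>M\<^esub> z"
      using y(1) span_insert_iff[OF b cs] by (auto simp: Cons)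
    have zM: "z \<in> carrier M" by (rule module_span_closed[OF cs z])
    have "\<omega> b (\<ominus>\<^bsub>M\<^esub> z) = \<omega> z b"
      using b zM \<omega>_skew[OF b zM] smult_l_minus[of \<one> z] \<omega>_smult_right[of "\<ominus> \<one>" z b]
      by (simp add: l_minus)
    also have "\<dots> = \<omega> y b" using a b zM by (simp add: y_eq \<omega>_linear)
    finally have bz: "\<omega> b (\<ominus>\<^bsub>M\<^esub> z) = \<one>" using yb by simp
    have z': "\<ominus>\<^bsub>M\<^esub> z \<in> module_span R M (set cs)" by (rule module_span_neg[OF cs z])
    show ?thesis
    proof (cases cs)
      case Nil
      then have "\<ominus>\<^bsub>M\<^esub> z = \<zero>\<^bsub>M\<^esub>" using z' by (simp add: module_span_empty)
      then have "\<zero> = \<one>" using bz b by simp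
      then have "v = \<zero>\<^bsub>M\<^esub>" if "v \<in> carrier M" for v
        using that smult_one smult_l_null by metis
      then have "?U = {\<zero>\<^bsub>M\<^esub>}" using module_span_closed[OF bs] span_zero by blast
      then show ?thesis by (intro exI[of _ "[]"]) (simp add: gens_def module_span_empty)
    next
      case (Cons c ds)
      have bcd: "set (b # c # ds) \<subseteq> carrier M" using bs \<open>bs = b # cs\<close> Cons by simp
      obtain c' where c': "c' \<in> carrier M" "\<omega> b c' = \<one>"
        and span: "module_span R M (insert b (insert c' (perp_proj b c' ` set ds))) = ?U"
        using split_hyperbolic_pair[OF fin bcd bz] z' \<open>bs = b # cs\<close> Cons by metis
      define es where "es = map (perp_proj b c') ds"
      have ds: "set ds \<subseteq> carrier M" using bcd by auto
      have es: "set es \<subseteq> carrier M"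
        using ds perp_proj_linear[OF b c'(1)] by (auto simp: es_def linear_map_def)
      have orth: "\<omega> b d = \<zero> \<and> \<omega> c' d = \<zero>" if "d \<in> set es" for d
        using that ds perp_proj_orthogonal[OF b c'] by (auto simp: es_def)
      have span': "module_span R M (insert b (insert c' (set es))) = ?U"
        using span by (simp add: es_def)
      let ?W = "module_span R M (set es)" and ?q = "card (carrier R)"
      note W = finite_span[OF fin es]
      have c'es: "insert c' (set es) \<subseteq> carrier M" using c' es by simp
      note f1 = finite_span_insert[OF fin c'(1) es conjunct1[OF W]]
      note f2 = finite_span_insert[OF fin b c'es f1(1)]
      have "?q ^ (2 + length es) = card ?U"
        using card \<open>bs = b # cs\<close> Cons by (simp add: es_def)
      also have "\<dots> \<le> ?q * (?q * card ?W)"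
        using f2(2) mult_le_mono2[OF f1(2), of ?q] unfolding span' by linarith
      finally have "?q * (?q * ?q ^ length es) \<le> ?q * (?q * card ?W)" by simp
      moreover have "?q > 0" using fin by (auto simp: card_gt_0_iff)
      ultimately have "?q ^ length es \<le> card ?W" by (simp only: mult_le_cancel1)
      then have card': "card ?W = ?q ^ length es" using W by simp
      have dual': "self_dual ?W"
        by (rule self_dual_complement[OF b c' es orth]) (use dual span' in simp_all)
      have "length es < length bs" using \<open>bs = b # cs\<close> Cons by (simp add: es_def)
      then obtain ps where ps: "hyperbolic ps" "module_span R M (gens ps) = ?W"
        using less.hyps[OF _ es card' dual'] by blast
      have gM: "gens ps \<subseteq> carrier M" by (rule hyperbolic_gens_carrier[OF ps(1)])
      have "\<omega> b g = \<zero> \<and> \<omega> c' g = \<zero>" if "g \<in> gens ps" for g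
      proof -
        have "g \<in> ?W" using module_span_incl[OF gM that] ps(2) by simp
        then show ?thesis
          using \<omega>_span_zero(1)[OF b es] \<omega>_span_zero(1)[OF c'(1) es] orth by blast
      qed
      then have hyp: "hyperbolic ((b, c') # ps)" using b c' ps(1) by simp
      have c'g: "insert c' (gens ps) \<subseteq> carrier M" using c' gM by simp
      have "module_span R M (gens ((b, c') # ps)) = ?U"
        unfolding gens_Cons fst_conv snd_conv span'[symmetric]
        by (intro span_insert_cong b c' c'g c'es gM es ps)
     with hyp show ?thesis by blast
    qed
  qed
qed

lemma hyperbolic_coordinates_surj:
  assumes "hyperbolic ps" "a \<in> {..<length ps} \<rightarrow> carrier R" "b \<in> {..<length ps} \<rightarrow> carrier R"
  shows "\<exists>v\<in>module_span R M (gens ps). \<forall>i<length ps.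
    \<omega> v (snd (ps ! i)) = a i \<and> \<omega> (fst (ps ! i)) v = b i"
  using assms
proof (induction ps arbitrary: a b)
  case Nil
  then show ?case by (auto intro: span_zero)
next
  case (Cons p ps)
  obtain x y where p: "p = (x, y)" by fastforce
  have hyp: "hyperbolic ps" and x: "x \<in> carrier M" and y: "y \<in> carrier M" and xy: "\<omega> x y = \<one>"
    and orth: "\<And>g. g \<in> gens ps \<Longrightarrow> \<omega> x g = \<zero>" "\<And>g. g \<in> gens ps \<Longrightarrow> \<omega> y g = \<zero>"
    using Cons.prems(1) by (auto simp: p)
  have ab: "a 0 \<in> carrier R" "b 0 \<in> carrier R" using Cons.prems by auto
  obtain z where z: "z \<in> module_span R M (gens ps)"
    and zi: "\<And>i. i < length ps \<Longrightarrow> \<omega> z (snd (ps ! i)) = a (Suc i) \<and> \<omega> (fst (ps ! i)) z = b (Suc i)"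
    using Cons.IH[OF hyp, of "\<lambda>i. a (Suc i)" "\<lambda>i. b (Suc i)"] Cons.prems(2,3) by (auto simp: Pi_iff)
  note gM = hyperbolic_gens_carrier[OF hyp]
  have zM: "z \<in> carrier M" by (rule module_span_closed[OF gM z])
  have mem: "fst (ps ! i) \<in> gens ps" "snd (ps ! i) \<in> gens ps" if "i < length ps" for i
    using that by (auto simp: gens_def)
  define v where "v = a 0 \<odot>\<^bsub>M\<^esub> x \<oplus>\<^bsub>M\<^esub> (b 0 \<odot>\<^bsub>M\<^esub> y \<oplus>\<^bsub>M\<^esub> z)"
  have "v \<in> module_span R M (gens (p # ps))"
    unfolding v_def gens_Cons using ab z module_span_mono[of "gens ps" "insert x (insert y (gens ps))" R M]
    by (auto simp: p intro!: span_step)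
  moreover have "\<omega> v (snd ((p # ps) ! i)) = a i \<and> \<omega> (fst ((p # ps) ! i)) v = b i"
    if i: "i < length (p # ps)" for i
  proof (cases i)
    case 0
    have "\<omega> z y = \<zero>" "\<omega> x z = \<zero>"
      using \<omega>_span_zero[OF x gM orth(1) z] \<omega>_span_zero[OF y gM orth(2) z] by auto
    then show ?thesis using ab x y zM xy by (simp add: 0 p v_def \<omega>_linear)
  next
    case (Suc j)
    then have j: "j < length ps" using i by simp
    have "fst (ps ! j) \<in> carrier M" "snd (ps ! j) \<in> carrier M" using mem[OF j] gM by auto
    moreover have "\<omega> (fst (ps ! j)) x = \<zero>" "\<omega> (fst (ps ! j)) y = \<zero>"
      using calculation orth mem[OF j] \<omega>_skew[of x "fst (ps ! j)"] \<omega>_skew[of y "fst (ps ! j)"] x y by auto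
    ultimately show ?thesis
      using ab x y zM zi[OF j] orth mem[OF j] Cons.prems(2,3) i
      by (simp add: Suc v_def \<omega>_linear Pi_iff)
  qed
  ultimately show ?case by blast
qed

lemma hyperbolic_form:
  assumes "hyperbolic ps" "v \<in> module_span R M (gens ps)" "u \<in> carrier M"
  shows "\<omega> v u = finsum R (\<lambda>i. \<omega> v (snd (ps ! i)) \<otimes> \<omega> (fst (ps ! i)) u
    \<ominus> \<omega> (fst (ps ! i)) v \<otimes> \<omega> u (snd (ps ! i))) {..<length ps}"
  using assms
proof (induction ps arbitrary: v)
  case Nil
  then have "v = \<zero>\<^bsub>M\<^esub>" by (simp add: gens_def module_span_empty)
  then show ?case using Nil \<omega>_skew[of u "\<zero>\<^bsub>M\<^esub>"] by simp
next
  case (Cons p ps)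
  obtain x y where p: "p = (x, y)" by fastforce
  have hyp: "hyperbolic ps" and x: "x \<in> carrier M" and y: "y \<in> carrier M" and xy: "\<omega> x y = \<one>"
    and orth: "\<And>g. g \<in> gens ps \<Longrightarrow> \<omega> x g = \<zero>" "\<And>g. g \<in> gens ps \<Longrightarrow> \<omega> y g = \<zero>"
    using Cons.prems(1) by (auto simp: p)
  note gM = hyperbolic_gens_carrier[OF hyp]
  have u: "u \<in> carrier M" by fact
  obtain s t z where st: "s \<in> carrier R" "t \<in> carrier R" and z: "z \<in> module_span R M (gens ps)"
    and v: "v = s \<odot>\<^bsub>M\<^esub> x \<oplus>\<^bsub>M\<^esub> (t \<odot>\<^bsub>M\<^esub> y \<oplus>\<^bsub>M\<^esub> z)"
    using span_insert2[OF x y gM, of v] Cons.prems(2) by (auto simp: gens_Cons p)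
  have zM: "z \<in> carrier M" by (rule module_span_closed[OF gM z])
  have vM: "v \<in> carrier M" using st x y zM by (simp add: v)
  have mem: "fst (ps ! i) \<in> gens ps" "snd (ps ! i) \<in> gens ps"
    "fst (ps ! i) \<in> carrier M" "snd (ps ! i) \<in> carrier M" if "i < length ps" for i
    using that gM by (auto simp: gens_def)
  have zxy: "\<omega> z y = \<zero>" "\<omega> x z = \<zero>"
    using \<omega>_span_zero[OF x gM orth(1) z] \<omega>_span_zero[OF y gM orth(2) z] by auto
  have tail: "\<omega> v (snd (ps ! i)) = \<omega> z (snd (ps ! i))" "\<omega> (fst (ps ! i)) v = \<omega> (fst (ps ! i)) z"
    if i: "i < length ps" for i
  proof -
    show "\<omega> v (snd (ps ! i)) = \<omega> z (snd (ps ! i))"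
      using mem[OF i] st x y zM orth by (simp add: v \<omega>_linear)
    show "\<omega> (fst (ps ! i)) v = \<omega> (fst (ps ! i)) z"
      using mem[OF i] st x y zM orth \<omega>_skew[of x "fst (ps ! i)"] \<omega>_skew[of y "fst (ps ! i)"]
      by (simp add: v \<omega>_linear)
  qed
  let ?T = "\<lambda>v ps i. \<omega> v (snd (ps ! i)) \<otimes> \<omega> (fst (ps ! i)) u \<ominus> \<omega> (fst (ps ! i)) v \<otimes> \<omega> u (snd (ps ! i))"
  have cl: "?T w ps i \<in> carrier R" if "w \<in> carrier M" "i < length ps" for w i
    using that mem u by simp
  have "finsum R (?T v (p # ps)) {..<length (p # ps)}
      = ?T v (p # ps) 0 \<oplus> finsum R (\<lambda>i. ?T v (p # ps) (Suc i)) {..<length ps}"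
    unfolding length_Cons
  proof (rule R.finsum_lessThan_Suc_shift, rule funcsetI)
    fix i assume "i \<in> {..<Suc (length ps)}"
    then show "?T v (p # ps) i \<in> carrier R"
      using vM u x y cl by (cases i) (auto simp: p)
  qed
  also have "finsum R (\<lambda>i. ?T v (p # ps) (Suc i)) {..<length ps} = finsum R (?T z ps) {..<length ps}"
    using tail cl[OF zM] by (intro R.finsum_cong') auto
  also have "\<dots> = \<omega> z u" using Cons.IH[OF hyp z u] by simp
  also have "?T v (p # ps) 0 = s \<otimes> \<omega> x u \<oplus> t \<otimes> \<omega> y u"
    using st x y zM u xy zxy \<omega>_skew[of u y] by (simp add: p v \<omega>_linear R.minus_eq r_minus)
  also have "s \<otimes> \<omega> x u \<oplus> t \<otimes> \<omega> y u \<oplus> \<omega> z u = \<omega> v u"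
    using st x y zM u by (simp add: v \<omega>_linear R.a_assoc)
  finally show ?case by simp
qed

end

text \<open>The coordinate functions of an isomorphism with the standard symplectic module of rank \<open>2n\<close>.\<close>

definition symplectic_coords ::
    "('r, 'x) ring_scheme \<Rightarrow> ('r, 'v, 'y) symplectic_scheme \<Rightarrow> nat
      \<Rightarrow> (nat \<Rightarrow> 'v \<Rightarrow> 'r) \<Rightarrow> (nat \<Rightarrow> 'v \<Rightarrow> 'r) \<Rightarrow> bool" where
  "symplectic_coords R V n p q \<longleftrightarrow>
     (\<forall>i<n. linear_map R V (regular_module R) (p i) \<and> linear_map R V (regular_module R) (q i)) \<and>
     (\<forall>a\<in>{..<n} \<rightarrow> carrier R. \<forall>b\<in>{..<n} \<rightarrow> carrier R.
        \<exists>!v. v \<in> carrier V \<and> (\<forall>i<n. p i v = a i \<and> q i v = b i)) \<and>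
     (\<forall>v\<in>carrier V. \<forall>u\<in>carrier V. form V v u =
        finsum R (\<lambda>i. (p i v \<otimes>\<^bsub>R\<^esub> q i u) \<ominus>\<^bsub>R\<^esub> (q i v \<otimes>\<^bsub>R\<^esub> p i u)) {..<n})"

lemma (in module) finsum_in_span:
  assumes "finite A" "G \<subseteq> carrier M" "\<And>i. i \<in> A \<Longrightarrow> f i \<in> module_span R M G"
  shows "finsum M f A \<in> module_span R M G"
  using assms(1,3)
proof (induction rule: finite_induct)
  case empty
  then show ?case by (simp add: span_zero)
next
  case (insert i A)
  then show ?case
    using module_span_closed[OF assms(2)] by (simp add: module_span_add[OF assms(2)] Pi_iff)
qed

lemma finite_rank_free_list:
  assumes V: "module R V" and fin: "finite (carrier R)" and free: "finite_rank_free R V"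
  obtains bs where "set bs \<subseteq> carrier V" "module_span R V (set bs) = carrier V"
    and "card (carrier V) = card (carrier R) ^ length bs"
proof -
  interpret V: module R V by fact
  from free[unfolded finite_rank_free_def] obtain n :: nat and b
    where nb: "b \<in> {..<n} \<rightarrow> carrier V \<and>
      (\<forall>v\<in>carrier V. \<exists>!c. c \<in> {..<n} \<rightarrow>\<^sub>E carrier R \<and>
         v = finsum V (\<lambda>i. c i \<odot>\<^bsub>V\<^esub> b i) {..<n})" by (elim exE)
  note b = conjunct1[OF nb] and uniq = bspec[OF conjunct2[OF nb]]
  define bs where "bs = map b [0..<n]"
  have bs: "set bs \<subseteq> carrier V" using b by (auto simp: bs_def)
  let ?f = "\<lambda>c. finsum V (\<lambda>i. c i \<odot>\<^bsub>V\<^esub> b i) {..<n}"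
  have closed: "?f c \<in> carrier V" if "c \<in> {..<n} \<rightarrow>\<^sub>E carrier R" for c
    using that b by (intro V.M.finsum_closed) (auto simp: Pi_iff PiE_iff)
  have "bij_betw ?f ({..<n} \<rightarrow>\<^sub>E carrier R) (carrier V)"
    unfolding bij_betw_def
  proof (intro conjI inj_onI)
    fix c d assume c: "c \<in> {..<n} \<rightarrow>\<^sub>E carrier R" and d: "d \<in> {..<n} \<rightarrow>\<^sub>E carrier R"
      and eq: "?f c = ?f d"
    obtain e where e: "\<forall>c'. c' \<in> {..<n} \<rightarrow>\<^sub>E carrier R \<and> ?f c = ?f c' \<longrightarrow> c' = e"
      using uniq[OF closed[OF c]] by (elim ex1E)
    have "c = e" using c by (intro e[rule_format] conjI refl)
    moreover have "d = e" using d eq by (intro e[rule_format] conjI)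
    ultimately show "c = d" by simp
  next
    show "?f ` ({..<n} \<rightarrow>\<^sub>E carrier R) = carrier V"
    proof (intro equalityI subsetI)
      fix v assume v: "v \<in> carrier V"
      obtain c where "c \<in> {..<n} \<rightarrow>\<^sub>E carrier R" "v = ?f c"
        using ex1_implies_ex[OF uniq[OF v]] by (elim exE conjE)
      then show "v \<in> ?f ` ({..<n} \<rightarrow>\<^sub>E carrier R)" by (intro image_eqI)
    next
      fix v assume "v \<in> ?f ` ({..<n} \<rightarrow>\<^sub>E carrier R)"
      then show "v \<in> carrier V" by (elim imageE) (simp only: closed)
    qed
  qed
  then have "card (carrier V) = card ({..<n} \<rightarrow>\<^sub>E carrier R)"
    by (rule bij_betw_same_card[symmetric])
  then have card: "card (carrier V) = card (carrier R) ^ length bs"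
    by (simp add: card_PiE bs_def)
  have "v \<in> module_span R V (set bs)" if v: "v \<in> carrier V" for v
  proof -
    obtain c where c: "c \<in> {..<n} \<rightarrow>\<^sub>E carrier R" "v = ?f c"
      using ex1_implies_ex[OF uniq[OF v]] by (elim exE conjE)
    have "?f c \<in> module_span R V (set bs)"
      using c(1) by (intro V.finsum_in_span bs V.module_span_smult V.module_span_incl)
        (auto simp: bs_def PiE_iff)
    then show ?thesis using c(2) by simp
  qed
  then have "module_span R V (set bs) = carrier V" using V.module_span_closed[OF bs] by blast
  then show thesis using that bs card by blast
qed

theorem symplectic_coordinates:
  fixes R :: "('r, 'x) ring_scheme" and V :: "('r, 'v, 'y) symplectic_scheme"
  assumes fin: "finite (carrier R)" and symp: "symplectic_module R V"
  obtains n p q where "symplectic_coords R V n p q"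
proof -
  have V: "module R V" and free: "finite_rank_free R V" and form: "symplectic_form R V (form V)"
    using symp by (auto simp: symplectic_module_def)
  interpret V: module R V by (rule V)
  have bij: "bij_betw (\<lambda>v. \<lambda>w\<in>carrier V. form V v w) (carrier V) (linear_maps R V (regular_module R))"
    using form by (simp add: symplectic_form_def)
  interpret alternating_form R V "form V"
  proof unfold_locales
    have lin: "linear_map R V (regular_module R) (\<lambda>w. form V v w)"
      "linear_map R V (regular_module R) (\<lambda>w. form V w v)" if "v \<in> carrier V" for v
      using form that by (simp_all add: symplectic_form_def)
    fix x y assume "x \<in> carrier V" "y \<in> carrier V"
    then show "form V x y \<in> carrier R"
      using lin(1)[of x] by (auto simp: linear_map_def regular_module_def)
    fix z assume "z \<in> carrier V"
    then show "form V (x \<oplus>\<^bsub>V\<^esub> y) z = form V x z \<oplus>\<^bsub>R\<^esub> form V y z"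
      "form V z (x \<oplus>\<^bsub>V\<^esub> y) = form V z x \<oplus>\<^bsub>R\<^esub> form V z y"
      using lin[of z] \<open>x \<in> carrier V\<close> \<open>y \<in> carrier V\<close>
      by (simp_all add: linear_map_def regular_module_def)
  next
    have lin: "linear_map R V (regular_module R) (\<lambda>w. form V v w)"
      "linear_map R V (regular_module R) (\<lambda>w. form V w v)" if "v \<in> carrier V" for v
      using form that by (simp_all add: symplectic_form_def)
    fix a x z assume "a \<in> carrier R" "x \<in> carrier V" "z \<in> carrier V"
    then show "form V (a \<odot>\<^bsub>V\<^esub> x) z = a \<otimes>\<^bsub>R\<^esub> form V x z"
      "form V z (a \<odot>\<^bsub>V\<^esub> x) = a \<otimes>\<^bsub>R\<^esub> form V z x"
      using lin[of z] by (simp_all add: linear_map_def regular_module_def)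
  next
    fix x assume "x \<in> carrier V"
    then show "form V x x = \<zero>\<^bsub>R\<^esub>" using form by (simp add: symplectic_form_def)
  qed
  obtain bs where bs: "set bs \<subseteq> carrier V" "module_span R V (set bs) = carrier V"
    "card (carrier V) = card (carrier R) ^ length bs"
    by (rule finite_rank_free_list[OF V fin free])
  have "self_dual (carrier V)"
    unfolding self_dual_def
  proof (intro allI impI)
    fix l assume "V.functional (carrier V) l"
    then have "restrict l (carrier V) \<in> linear_maps R V (regular_module R)"
      by (auto simp: V.functional_def linear_maps_def linear_map_def regular_module_def)
    then obtain y where y: "y \<in> carrier V" "restrict l (carrier V) = (\<lambda>w\<in>carrier V. form V y w)"
      using bij unfolding bij_betw_def by (metis (no_types, lifting) imageE)
    then have "form V y v = l v" if "v \<in> carrier V" for v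
      using that by (metis (no_types, lifting) restrict_apply')
    then show "\<exists>y\<in>carrier V. \<forall>v\<in>carrier V. form V y v = l v" using y(1) by blast
  qed
  then obtain ps where ps: "hyperbolic ps" "module_span R V (gens ps) = carrier V"
    using hyperbolic_basis[OF fin bs(1)] bs(2,3) by auto
  define n p q where "n = length ps" and "p i v = form V v (snd (ps ! i))"
    and "q i v = form V (fst (ps ! i)) v" for i v
  have mem: "fst (ps ! i) \<in> carrier V" "snd (ps ! i) \<in> carrier V" if "i < n" for i
    using that hyperbolic_gens_carrier[OF ps(1)] by (auto simp: gens_def n_def)
  have sum: "form V v u = finsum R (\<lambda>i. (p i v \<otimes>\<^bsub>R\<^esub> q i u) \<ominus>\<^bsub>R\<^esub> (q i v \<otimes>\<^bsub>R\<^esub> p i u)) {..<n}"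
    if "v \<in> carrier V" "u \<in> carrier V" for u v
    using hyperbolic_form[OF ps(1)] that ps(2) by (simp add: n_def p_def q_def)
  have inj: "v = v'" if v: "v \<in> carrier V" "v' \<in> carrier V"
    and eq: "\<And>i. i < n \<Longrightarrow> p i v = p i v' \<and> q i v = q i v'" for v v'
  proof -
    have "form V v u = form V v' u" if u: "u \<in> carrier V" for u
      unfolding sum[OF v(1) u] sum[OF v(2) u]
      using eq v u mem by (intro V.R.finsum_cong') (auto simp: p_def q_def)
    then have "(\<lambda>w\<in>carrier V. form V v w) = (\<lambda>w\<in>carrier V. form V v' w)" by auto
    then show ?thesis using bij v by (auto simp: bij_betw_def dest: inj_onD)
  qed
  have "symplectic_coords R V n p q"
    unfolding symplectic_coords_def
  proof (intro conjI allI impI ballI)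
    fix i assume "i < n"
    then show "linear_map R V (regular_module R) (p i)" "linear_map R V (regular_module R) (q i)"
      using mem[of i] by (auto simp: linear_map_def regular_module_def p_def q_def \<omega>_linear)
  next
    fix a b assume "a \<in> {..<n} \<rightarrow> carrier R" "b \<in> {..<n} \<rightarrow> carrier R"
    then obtain v where "v \<in> carrier V" "\<forall>i<n. p i v = a i \<and> q i v = b i"
      using hyperbolic_coordinates_surj[OF ps(1), of a b] ps(2) by (auto simp: n_def p_def q_def)
    then show "\<exists>!v. v \<in> carrier V \<and> (\<forall>i<n. p i v = a i \<and> q i v = b i)"
      using inj by (intro ex1I[of _ v]) auto
  qed (rule sum)
  then show thesis by (rule that)
qed

section \<open>Words and symplectic embeddings\<close>

lemma finite_symplectic_module:
  assumes fin: "finite (carrier R)" and V: "symplectic_module R V"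
  shows "finite (carrier V)"
proof -
  have mod: "module R V" and free: "finite_rank_free R V"
    using V by (simp_all add: symplectic_module_def)
  obtain bs where "set bs \<subseteq> carrier V" "module_span R V (set bs) = carrier V"
    by (rule finite_rank_free_list[OF mod fin free])
  then show ?thesis using module.finite_span[OF mod fin] by force
qed

text \<open>The order of the additive group of \<open>R\<close> kills \<open>R\<close>, so a fibre contributes its value exactly once.\<close>

lemma (in cring) finsum_regular_surj:
  assumes fin: "finite (carrier R)" and s: "regular_surj (card (carrier R)) n n' s"
    and h: "h \<in> {..<n} \<rightarrow> carrier R"
  shows "(\<Oplus>j\<in>{..<n'}. h (s j)) = (\<Oplus>i\<in>{..<n}. h i)"
proof -
  let ?F = "\<lambda>i. {j\<in>{..<n'}. s j = i}"
  have "s j < n" if "j < n'" for j using s that by (auto simp: regular_surj_def Pi_iff)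
  then have un: "{..<n'} = (\<Union>i\<in>{..<n}. ?F i)" by auto
  have "(\<Oplus>j\<in>{..<n'}. h (s j)) = (\<Oplus>j\<in>(\<Union>i\<in>{..<n}. ?F i). h (s j))"
    by (rule arg_cong[OF un])
  also have "\<dots> = (\<Oplus>i\<in>{..<n}. \<Oplus>j\<in>?F i. h (s j))"
    using h by (intro add.finprod_UN_disjoint) (auto simp: pairwise_def disjnt_def)
  also have "\<dots> = (\<Oplus>i\<in>{..<n}. h i)"
  proof (rule add.finprod_cong')
    fix i assume "i \<in> {..<n}"
    then have i: "i < n" and hi: "h i \<in> carrier R" using h by auto
    obtain m where m: "card (?F i) = Suc (card (carrier R) * m)"
      using s i unfolding regular_surj_def by blast
    have "add_pow R (card (carrier R)) (h i) = \<zero>"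
      using add.pow_order_eq_1[OF hi] by (simp add: add_pow_def order_def)
    then have zero: "add_pow R (card (carrier R) * m) (h i) = \<zero>"
      using add.nat_pow_pow[OF hi, of m "card (carrier R)"] by simp
    have "(\<Oplus>j\<in>?F i. h (s j)) = (\<Oplus>j\<in>?F i. h i)"
      using hi by (intro add.finprod_cong') auto
    also have "\<dots> = add_pow R (Suc (card (carrier R) * m)) (h i)"
      using add.finprod_const[OF hi, of "?F i"] m by simp
    also have "\<dots> = h i" using zero hi by simp
    finally show "(\<Oplus>j\<in>?F i. h (s j)) = h i" .
  qed (use h in auto)
  finally show ?thesis .
qed

lemma symplectic_coords_linear:
  assumes "symplectic_coords R V n p q" "i < n"
  shows "\<And>v. v \<in> carrier V \<Longrightarrow> p i v \<in> carrier R \<and> q i v \<in> carrier R"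
    and "\<And>u v. \<lbrakk>u \<in> carrier V; v \<in> carrier V\<rbrakk> \<Longrightarrow> p i (u \<oplus>\<^bsub>V\<^esub> v) = p i u \<oplus>\<^bsub>R\<^esub> p i v
      \<and> q i (u \<oplus>\<^bsub>V\<^esub> v) = q i u \<oplus>\<^bsub>R\<^esub> q i v"
    and "\<And>a v. \<lbrakk>a \<in> carrier R; v \<in> carrier V\<rbrakk> \<Longrightarrow> p i (a \<odot>\<^bsub>V\<^esub> v) = a \<otimes>\<^bsub>R\<^esub> p i v
      \<and> q i (a \<odot>\<^bsub>V\<^esub> v) = a \<otimes>\<^bsub>R\<^esub> q i v"
proof -
  have "linear_map R V (regular_module R) (p i)" "linear_map R V (regular_module R) (q i)"
    using assms by (simp_all add: symplectic_coords_def)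
  then show "\<And>v. v \<in> carrier V \<Longrightarrow> p i v \<in> carrier R \<and> q i v \<in> carrier R"
    and "\<And>u v. \<lbrakk>u \<in> carrier V; v \<in> carrier V\<rbrakk> \<Longrightarrow> p i (u \<oplus>\<^bsub>V\<^esub> v) = p i u \<oplus>\<^bsub>R\<^esub> p i v
      \<and> q i (u \<oplus>\<^bsub>V\<^esub> v) = q i u \<oplus>\<^bsub>R\<^esub> q i v"
    and "\<And>a v. \<lbrakk>a \<in> carrier R; v \<in> carrier V\<rbrakk> \<Longrightarrow> p i (a \<odot>\<^bsub>V\<^esub> v) = a \<otimes>\<^bsub>R\<^esub> p i v
      \<and> q i (a \<odot>\<^bsub>V\<^esub> v) = a \<otimes>\<^bsub>R\<^esub> q i v"
    by (auto simp: linear_map_def regular_module_def)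
qed

lemma symplectic_coords_ex1:
  assumes "symplectic_coords R V n p q" "\<And>i. i < n \<Longrightarrow> a i \<in> carrier R \<and> b i \<in> carrier R"
  shows "\<exists>!v. v \<in> carrier V \<and> (\<forall>i<n. p i v = a i \<and> q i v = b i)"
proof -
  have "a \<in> {..<n} \<rightarrow> carrier R" "b \<in> {..<n} \<rightarrow> carrier R" using assms(2) by auto
  then show ?thesis using assms(1) by (simp add: symplectic_coords_def)
qed

lemma symplectic_coords_eqI:
  assumes co: "symplectic_coords R V n p q" and uv: "u \<in> carrier V" "v \<in> carrier V"
    and eq: "\<And>i. i < n \<Longrightarrow> p i u = p i v \<and> q i u = q i v"
  shows "u = v"
proof -
  have "\<exists>!w. w \<in> carrier V \<and> (\<forall>i<n. p i w = p i v \<and> q i w = q i v)"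
    by (rule symplectic_coords_ex1[OF co symplectic_coords_linear(1)[OF co _ uv(2)]])
  then show ?thesis using uv eq by (elim ex1E) metis
qed

text \<open>The morphism copies the pair of coordinates number \<open>s j\<close> to the position \<open>j\<close>. The form is a sum
  over the positions, so composition with \<open>s\<close> leaves it unchanged.\<close>

lemma regular_surj_morphism:
  assumes R: "cring R" and fin: "finite (carrier R)"
    and V: "symplectic_module R V" and W: "symplectic_module R W"
    and co: "symplectic_coords R V n p q" and co': "symplectic_coords R W n' p' q'"
    and s: "regular_surj (card (carrier R)) n n' s"
  obtains g where "g \<in> Mor (SI R) V W"
    and "\<And>v j. \<lbrakk>v \<in> carrier V; j < n'\<rbrakk> \<Longrightarrow> p' j (g v) = p (s j) v \<and> q' j (g v) = q (s j) v"
proof -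
  interpret V: module R V using V by (simp add: symplectic_module_def)
  interpret W: module R W using W by (simp add: symplectic_module_def)
  have s_less: "s j < n" if "j < n'" for j using s that by (auto simp: regular_surj_def)
  note lin = symplectic_coords_linear[OF co] and lin' = symplectic_coords_linear[OF co']
  have "\<exists>w. w \<in> carrier W \<and> (\<forall>j<n'. p' j w = p (s j) v \<and> q' j w = q (s j) v)"
    if v: "v \<in> carrier V" for v
    using symplectic_coords_ex1[OF co', of "\<lambda>j. p (s j) v" "\<lambda>j. q (s j) v"] lin(1) s_less v
    by (intro ex1_implies_ex) simp
  then obtain g0 where g0: "\<And>v. v \<in> carrier V \<Longrightarrow>
      g0 v \<in> carrier W \<and> (\<forall>j<n'. p' j (g0 v) = p (s j) v \<and> q' j (g0 v) = q (s j) v)"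
    by metis
  define g where "g = restrict g0 (carrier V)"
  have g: "g v \<in> carrier W" "\<And>j. j < n' \<Longrightarrow> p' j (g v) = p (s j) v \<and> q' j (g v) = q (s j) v"
    if "v \<in> carrier V" for v
    using g0[OF that] that by (simp_all add: g_def)
  note eqI = symplectic_coords_eqI[OF co']
  have add: "g (u \<oplus>\<^bsub>V\<^esub> v) = g u \<oplus>\<^bsub>W\<^esub> g v" if "u \<in> carrier V" "v \<in> carrier V" for u v
    using that g s_less lin(2) lin'(2) by (intro eqI) auto
  have smult: "g (a \<odot>\<^bsub>V\<^esub> v) = a \<odot>\<^bsub>W\<^esub> g v" if "a \<in> carrier R" "v \<in> carrier V" for a v
    using that g s_less lin(3) lin'(3) by (intro eqI) auto
  have form: "form W (g u) (g v) = form V u v" if u: "u \<in> carrier V" and v: "v \<in> carrier V" for u v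
  proof -
    let ?h = "\<lambda>i. (p i u \<otimes>\<^bsub>R\<^esub> q i v) \<ominus>\<^bsub>R\<^esub> (q i u \<otimes>\<^bsub>R\<^esub> p i v)"
    have h: "?h \<in> {..<n} \<rightarrow> carrier R" using lin(1) u v by (auto simp: Pi_iff)
    have "form W (g u) (g v) = finsum R (\<lambda>j. (p' j (g u) \<otimes>\<^bsub>R\<^esub> q' j (g v))
        \<ominus>\<^bsub>R\<^esub> (q' j (g u) \<otimes>\<^bsub>R\<^esub> p' j (g v))) {..<n'}"
      using co' g(1)[OF u] g(1)[OF v] by (simp add: symplectic_coords_def)
    also have "\<dots> = finsum R (\<lambda>j. ?h (s j)) {..<n'}"
      using g(2)[OF u] g(2)[OF v] h s_less by (intro V.R.finsum_cong') (auto simp: Pi_iff)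
    also have "\<dots> = finsum R ?h {..<n}"
      using V.R.finsum_regular_surj[OF fin s h] .
    also have "\<dots> = form V u v" using co u v by (simp add: symplectic_coords_def)
    finally show ?thesis .
  qed
  have "g \<in> Mor (SI R) V W"
    using g(1) add smult form
    by (simp add: SI_def linear_maps_def linear_map_def) (simp add: g_def)
  then show thesis using that g(2) by blast
qed

text \<open>A morphism \<open>f : X \<rightarrow> Y\<close> is the word whose \<open>i\<close>-th letter is the pair of coordinates number \<open>i\<close> of
  \<open>f\<close>, a function on the finite set \<open>X\<close>. So the alphabet depends on \<open>X\<close> but not on \<open>Y\<close>. Numbering the
  letters and comparing words lexicographically gives the ranks.\<close>

theorem theorem5:
  fixes R :: "'r ring"
  assumes "cring R" and "finite (carrier R)"
    and "infinite (UNIV :: 'v set)"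
  shows "locally_noetherian (SI R :: (('r, 'v) symplectic, 'v \<Rightarrow> 'v) category)
           TYPE('k) TYPE('m)"
proof -
  note fin = assms(2)
  let ?C = "SI R :: (('r, 'v) symplectic, 'v \<Rightarrow> 'v) category"
  have Obj: "X \<in> Obj ?C \<longleftrightarrow> symplectic_module R X" for X by (simp add: SI_def)
  have Mor: "f x \<in> carrier Y" if "f \<in> Mor ?C X Y" "x \<in> carrier X" for f X Y x
    using that by (auto simp: SI_def linear_maps_def linear_map_def)
  have Mor_ext: "f \<in> extensional (carrier X)" if "f \<in> Mor ?C X Y" for f X Y
    using that by (auto simp: SI_def linear_maps_def)
  have "\<exists>n p q. symplectic_coords R X n p q" if "X \<in> Obj ?C" for X
    using symplectic_coordinates[OF fin] that Obj by metis
  then obtain dim p q where co: "\<And>X. X \<in> Obj ?C \<Longrightarrow> symplectic_coords R X (dim X) (p X) (q X)"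
    by metis
  define A where "A X = carrier X \<rightarrow>\<^sub>E carrier R \<times> carrier R" for X :: "('r, 'v) symplectic"
  have finite_A: "finite (A X)" if "X \<in> Obj ?C" for X
    using fin finite_symplectic_module[OF fin] that Obj by (auto simp: A_def intro!: finite_PiE)
  then have "\<exists>code :: ('v \<Rightarrow> 'r \<times> 'r) \<Rightarrow> nat. inj_on code (A X)" if "X \<in> Obj ?C" for X
    using that finite_imp_inj_to_nat_seg by metis
  then obtain code :: "('r, 'v) symplectic \<Rightarrow> ('v \<Rightarrow> 'r \<times> 'r) \<Rightarrow> nat"
    where code: "\<And>X. X \<in> Obj ?C \<Longrightarrow> inj_on (code X) (A X)" by metis
  define word where "word X Y f = map (\<lambda>i. \<lambda>x\<in>carrier X. (p Y i (f x), q Y i (f x))) [0..<dim Y]"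
    for X Y :: "('r, 'v) symplectic" and f
  define rk where "rk X Y f = map (code X) (word X Y f)" for X Y f
  have len: "length (word X Y f) = dim Y" for X Y f by (simp add: word_def)
  have word_A: "set (word X Y f) \<subseteq> A X" if "Y \<in> Obj ?C" "f \<in> Mor ?C X Y" for X Y f
    using symplectic_coords_linear(1)[OF co[OF that(1)]] Mor[OF that(2)]
    by (auto simp: word_def A_def)
  have word_inj: "f = f'" if Y: "Y \<in> Obj ?C" and f: "f \<in> Mor ?C X Y" and f': "f' \<in> Mor ?C X Y"
    and eq: "word X Y f = word X Y f'" for X Y f f'
  proof (rule extensionalityI[OF Mor_ext[OF f] Mor_ext[OF f']])
    fix x assume x: "x \<in> carrier X"
    have "p Y i (f x) = p Y i (f' x) \<and> q Y i (f x) = q Y i (f' x)" if i: "i < dim Y" for i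
    proof -
      have "word X Y f ! i = word X Y f' ! i" using eq by simp
      then have "(\<lambda>x\<in>carrier X. (p Y i (f x), q Y i (f x))) = (\<lambda>x\<in>carrier X. (p Y i (f' x), q Y i (f' x)))"
        using i by (simp add: word_def)
      from fun_cong[OF this, of x] x show ?thesis by simp
    qed
    then show "f x = f' x"
      by (rule symplectic_coords_eqI[OF co[OF Y] Mor[OF f x] Mor[OF f' x]])
  qed
  show ?thesis
  proof (rule groebner_criterion[of ?C rk])
    fix X Y assume X: "X \<in> Obj ?C" and Y: "Y \<in> Obj ?C"
    show "inj_on (rk X Y) (Mor ?C X Y)"
    proof (rule inj_onI)
      fix f f' assume f: "f \<in> Mor ?C X Y" "f' \<in> Mor ?C X Y" and "rk X Y f = rk X Y f'"
      then have "word X Y f = word X Y f'"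
        using code[OF X] word_A[OF Y f(1)] word_A[OF Y f(2)]
        by (auto simp: rk_def intro: map_inj_on inj_on_subset)
      then show "f = f'" by (rule word_inj[OF Y f])
    qed
  next
    fix X :: "('r, 'v) symplectic" and Y and f :: "nat \<Rightarrow> 'v \<Rightarrow> 'v"
    assume X: "X \<in> Obj ?C" and Y: "\<And>i::nat. Y i \<in> Obj ?C" and f: "\<And>i. f i \<in> Mor ?C X (Y i)"
    have N: "card (carrier R) > 0"
      using fin cring.cring_simprules(6)[OF assms(1)] by (auto simp: card_gt_0_iff)
    obtain i j s where ij: "i < j"
      and s: "regular_surj (card (carrier R)) (dim (Y i)) (dim (Y j)) s"
      and wj: "word X (Y j) (f j) = map (\<lambda>l. word X (Y i) (f i) ! s l) [0..<dim (Y j)]"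
      using regular_surj_good_pair[of "A X" "card (carrier R)" "\<lambda>i. word X (Y i) (f i)"]
        finite_A[OF X] N word_A[OF Y f]
      unfolding len by metis
    have YR: "symplectic_module R (Y i)" "symplectic_module R (Y j)" using Y Obj by auto
    obtain g where g: "g \<in> Mor ?C (Y i) (Y j)"
      and gc: "\<And>v l. \<lbrakk>v \<in> carrier (Y i); l < dim (Y j)\<rbrakk>
        \<Longrightarrow> p (Y j) l (g v) = p (Y i) (s l) v \<and> q (Y j) l (g v) = q (Y i) (s l) v"
      by (rule regular_surj_morphism[OF assms(1) fin YR co[OF Y] co[OF Y] s]) blast
    have s_less: "s l < dim (Y i)" if "l < dim (Y j)" for l
      using s that by (auto simp: regular_surj_def)
    \<comment> \<open>composition with \<open>g\<close> acts on all words as composition with \<open>s\<close>\<close>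
    have word_g: "word X (Y j) (Comp ?C X (Y i) (Y j) g h) = map (\<lambda>l. word X (Y i) h ! s l) [0..<dim (Y j)]"
      if h: "h \<in> Mor ?C X (Y i)" for h
    proof (rule nth_equalityI)
      fix l assume "l < length (word X (Y j) (Comp ?C X (Y i) (Y j) g h))"
      then have l: "l < dim (Y j)" by (simp add: len)
      show "word X (Y j) (Comp ?C X (Y i) (Y j) g h) ! l = map (\<lambda>l. word X (Y i) h ! s l) [0..<dim (Y j)] ! l"
        using l s_less[OF l] gc[OF Mor[OF h] l] by (auto simp: word_def SI_def compose_def)
    qed (simp add: len)
    have rk_g: "rk X (Y j) (Comp ?C X (Y i) (Y j) g h) = map (\<lambda>l. rk X (Y i) h ! s l) [0..<dim (Y j)]"
      if "h \<in> Mor ?C X (Y i)" for h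
      unfolding rk_def word_g[OF that] using s_less by (simp add: len)
    have comp: "Comp ?C X (Y i) (Y j) g (f i) = f j"
    proof (rule word_inj[OF Y category.Comp_closed[OF SI_category X Y Y f g] f])
      show "word X (Y j) (Comp ?C X (Y i) (Y j) g (f i)) = word X (Y j) (f j)"
        unfolding wj by (rule word_g[OF f])
    qed
    have "rk X (Y j) (Comp ?C X (Y i) (Y j) g h) < rk X (Y j) (f j)"
      if h: "h \<in> Mor ?C X (Y i)" and less: "rk X (Y i) h < rk X (Y i) (f i)" for h
      unfolding comp[symmetric] rk_g[OF h] rk_g[OF f]
      by (rule regular_surj_less[OF s _ _ less]) (simp_all add: rk_def len)
    then show "\<exists>i j. i < j \<and> dominates ?C rk X (Y i) (f i) (Y j) (f j)"
      using ij g comp unfolding dominates_def by blast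
  qed
qed

end
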